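(* Let $G$ be a locally compact abelian group with a compact open subgroup $H$, and let $A\in\operatorname{Aut}(G)$ be expansive with respect to $H$ and such that $A^*$ is expansive with respect to $H^\perp$. Let $\varphi\in\mathscr{M}^1(G)$, $\varphi\neq0$, and let $\Lambda\subseteq G\times\widehat{G}$ be any sequence with $D^+(\Lambda)<+\infty$. Then $S(\varphi,\Lambda)$ is a Bessel sequence in $L^2(G)$.
   Context: Locally compact abelian (LCA) groups are Hausdorff and written additively; $\widehat{G}$ is the Pontryagin dual, $\langle x,\xi\rangle$ denotes the character $\xi$ evaluated at $x$, and $H^\perp=\{\xi\in\widehat{G}:\langle h,\xi\rangle=1\ \forall h\in H\}$. Haar measures are normalized by $m_G(H)=1$, $m_{\widehat{G}}(H^\perp)=1$. $\operatorname{Aut}(G)$ is the group of homeomorphic automorphisms of $G$; the modulus $|A|>0$ of $A\in\operatorname{Aut}(G)$ is defined by $m_G(AU)=|A|\,m_G(U)$ for Borel $U$; the adjoint $A^*\in\operatorname{Aut}(\widehat{G})$ is given by $\langle Ax,\gamma\rangle=\langle x,A^*\gamma\rangle$. $A$ is expansive with respect to a compact open subgroup $H$ if $H\subsetneq AH$ and $\bigcap_{n\le0}A^nH=\{0\}$. For $n\in\mathbb{Z}$ and $(x,\xi)\in G\times\widehat{G}$, $Q_n(x,\xi)=(x+A^nH)\times(\xi+(A^* )^nH^\perp)$. The upper density is $$D^+(\Lambda)=\limsup_{n\to+\infty}\frac{1}{|A|^{2n}}\max_{(x,\xi)\in G\times\widehat{G}}\#\{\Lambda\cap Q_n(x,\xi)\},$$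 where the maximum may be $+\infty$. Translation and modulation on $L^2(G)$: $T_xf(y)=f(y-x)$, $M_\xi f(y)=\langle y,\xi\rangle f(y)$. The Gabor system is $S(\varphi,\Lambda)=\{M_\xi T_x\varphi\}_{(x,\xi)\in\Lambda}$. A family $\{\varphi_i\}_{i\in I}$ in a Hilbert space $\mathcal{H}$ is a Bessel sequence if there is $B>0$ with $\sum_{i\in I}|\langle f,\varphi_i\rangle|^2\le B\|f\|^2$ for all $f\in\mathcal{H}$. Short-time Fourier transform: $V_gf(x,\xi)=\langle f,M_\xi T_xg\rangle$ for $f,g\in L^2(G)$. The modulation space $\mathscr{M}^1(G)$ is $\{f\in L^2(G):V_gf\in L^1(G\times\widehat{G})\}$ for a fixed non-zero $g\in L^2(G)$ with $V_gg\in L^1(G\times\widehat{G})$; it does not depend on the choice of such $g$. *)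

theory Defs
  imports "HOL-Analysis.Analysis"
begin

typedef (overloaded) ('a::topological_ab_group_add) pdual =
  "{\<theta>. continuous_on UNIV (\<theta> :: 'a \<Rightarrow> complex) \<and>
      (\<forall>x. cmod (\<theta> x) = 1) \<and> (\<forall>x y. \<theta> (x + y) = \<theta> x * \<theta> y)}"
  morphisms char_of Abs_pdual
  by (rule exI[of _ "\<lambda>_. 1"]) simp

setup_lifting type_definition_pdual

definition pairing :: "'a::topological_ab_group_add \<Rightarrow> 'a pdual \<Rightarrow> complex" where
  "pairing x \<xi> = char_of \<xi> x"

lemma continuous_on_pairing: "continuous_on S (\<lambda>x. pairing x \<xi>)"
  using char_of[of \<xi>] by (auto simp: pairing_def intro: continuous_on_subset)

lemma norm_pairing [simp]: "cmod (pairing x \<xi>) = 1"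
  using char_of[of \<xi>] by (auto simp: pairing_def)

lemma pairing_add_left: "pairing (x + y) \<xi> = pairing x \<xi> * pairing y \<xi>"
  using char_of[of \<xi>] by (auto simp: pairing_def)

lemma pdual_eqI: "(\<And>x. pairing x \<xi> = pairing x \<eta>) \<Longrightarrow> \<xi> = \<eta>"
  by (auto simp: pairing_def fun_eq_iff simp flip: char_of_inject)

instantiation pdual :: (topological_ab_group_add) ab_group_add
begin

lift_definition zero_pdual :: "'a pdual" is "\<lambda>_. 1"
  by simp

lift_definition plus_pdual :: "'a pdual \<Rightarrow> 'a pdual \<Rightarrow> 'a pdual" is "\<lambda>\<theta> \<psi> x. \<theta> x * \<psi> x"
  by (auto simp: norm_mult intro!: continuous_intros)

lift_definition uminus_pdual :: "'a pdual \<Rightarrow> 'a pdual" is "\<lambda>\<theta> x. cnj (\<theta> x)"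
  by (auto intro!: continuous_intros)

definition minus_pdual :: "'a pdual \<Rightarrow> 'a pdual \<Rightarrow> 'a pdual" where
  "minus_pdual \<xi> \<eta> = \<xi> + - \<eta>"

instance
proof
  fix a b c :: "'a pdual"
  show "a + b + c = a + (b + c)"
    by transfer (simp add: mult.assoc)
  show "a + b = b + a"
    by transfer (simp add: mult.commute)
  show "0 + a = a"
    by transfer simp
  show "- a + a = 0"
  proof transfer
    fix \<theta> :: "'a \<Rightarrow> complex"
    assume "continuous_on UNIV \<theta> \<and> (\<forall>x. cmod (\<theta> x) = 1) \<and> (\<forall>x y. \<theta> (x + y) = \<theta> x * \<theta> y)"
    then have "cnj (\<theta> x) * \<theta> x = 1" for x
      using complex_norm_square[of "\<theta> x"] by (simp add: mult.commute)
    then show "(\<lambda>x. cnj (\<theta> x) * \<theta> x) = (\<lambda>_. 1)"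
      by simp
  qed
  show "a - b = a + - b"
    by (rule minus_pdual_def)
qed

end

lemma pairing_zero_right [simp]: "pairing x 0 = 1"
  by (simp add: pairing_def zero_pdual.rep_eq)

lemma pairing_add_right: "pairing x (\<xi> + \<eta>) = pairing x \<xi> * pairing x \<eta>"
  by (simp add: pairing_def plus_pdual.rep_eq)

lemma pairing_uminus_right: "pairing x (- \<xi>) = cnj (pairing x \<xi>)"
  by (simp add: pairing_def uminus_pdual.rep_eq)

text \<open>The topology of uniform convergence on compact sets, which on the dual is the
  compact-open topology.\<close>

definition pdual_nbhd :: "'a::topological_ab_group_add pdual \<Rightarrow> 'a set \<Rightarrow> real \<Rightarrow> 'a pdual set" where
  "pdual_nbhd \<xi> K e = {\<eta>. \<forall>x\<in>K. cmod (pairing x \<eta> - pairing x \<xi>) < e}"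

lemma pdual_nbhd_mono: "K \<subseteq> K' \<Longrightarrow> e' \<le> e \<Longrightarrow> pdual_nbhd \<xi> K' e' \<subseteq> pdual_nbhd \<xi> K e"
  by (force simp: pdual_nbhd_def)

instantiation pdual :: (topological_ab_group_add) topological_space
begin

definition open_pdual :: "'a pdual set \<Rightarrow> bool" where
  "open_pdual U \<longleftrightarrow> (\<forall>\<xi>\<in>U. \<exists>K e. compact K \<and> e > 0 \<and> pdual_nbhd \<xi> K e \<subseteq> U)"

instance
proof
  show "open (UNIV :: 'a pdual set)"
    unfolding open_pdual_def
  proof
    fix \<xi> :: "'a pdual"
    have "compact ({} :: 'a set) \<and> (1::real) > 0 \<and> pdual_nbhd \<xi> {} 1 \<subseteq> UNIV"
      by simp
    then show "\<exists>K e. compact K \<and> e > 0 \<and> pdual_nbhd \<xi> K e \<subseteq> UNIV"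
      by (rule_tac x = "{}" in exI, rule_tac x = 1 in exI)
  qed
next
  fix S T :: "'a pdual set"
  assume S: "open S" and T: "open T"
  show "open (S \<inter> T)"
    unfolding open_pdual_def
  proof
    fix \<xi> assume "\<xi> \<in> S \<inter> T"
    then have "\<xi> \<in> S" "\<xi> \<in> T"
      by simp_all
    obtain K e where "compact K" "e > 0" "pdual_nbhd \<xi> K e \<subseteq> S"
      using bspec[OF S[unfolded open_pdual_def] \<open>\<xi> \<in> S\<close>] by (elim exE conjE)
    moreover obtain L d where "compact L" "d > 0" "pdual_nbhd \<xi> L d \<subseteq> T"
      using bspec[OF T[unfolded open_pdual_def] \<open>\<xi> \<in> T\<close>] by (elim exE conjE)
    moreover have "pdual_nbhd \<xi> (K \<union> L) (min e d) \<subseteq> pdual_nbhd \<xi> K e"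
        "pdual_nbhd \<xi> (K \<union> L) (min e d) \<subseteq> pdual_nbhd \<xi> L d"
      by (simp_all add: pdual_nbhd_mono)
    ultimately have "compact (K \<union> L)" "min e d > 0" "pdual_nbhd \<xi> (K \<union> L) (min e d) \<subseteq> S \<inter> T"
      by auto
    then show "\<exists>K e. compact K \<and> e > 0 \<and> pdual_nbhd \<xi> K e \<subseteq> S \<inter> T"
      by (intro exI[of _ "K \<union> L"] exI[of _ "min e d"] conjI)
  qed
next
  fix \<U> :: "'a pdual set set"
  assume *: "\<forall>S\<in>\<U>. open S"
  show "open (\<Union>\<U>)"
    unfolding open_pdual_def
  proof
    fix \<xi> assume "\<xi> \<in> \<Union>\<U>"
    then obtain S where "S \<in> \<U>" "\<xi> \<in> S" by blast
    have "open S"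
      using * \<open>S \<in> \<U>\<close> by simp
    obtain K e where "compact K" "e > 0" "pdual_nbhd \<xi> K e \<subseteq> S"
      using bspec[OF \<open>open S\<close>[unfolded open_pdual_def] \<open>\<xi> \<in> S\<close>] by (elim exE conjE)
    moreover from this(3) \<open>S \<in> \<U>\<close> have "pdual_nbhd \<xi> K e \<subseteq> \<Union>\<U>"
      by (rule order_trans[OF _ Union_upper])
    ultimately show "\<exists>K e. compact K \<and> e > 0 \<and> pdual_nbhd \<xi> K e \<subseteq> \<Union>\<U>"
      by (intro exI[of _ K] exI[of _ e] conjI)
  qed
qed

end

lemma centre_in_pdual_nbhd: "e > 0 \<Longrightarrow> \<xi> \<in> pdual_nbhd \<xi> K e"
  by (simp add: pdual_nbhd_def)

lemma open_pdual_nbhd: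
  assumes "compact K"
  shows "open (pdual_nbhd \<xi> K e)"
  unfolding open_pdual_def
proof
  fix \<eta> assume \<eta>: "\<eta> \<in> pdual_nbhd \<xi> K e"
  show "\<exists>L d. compact L \<and> d > 0 \<and> pdual_nbhd \<eta> L d \<subseteq> pdual_nbhd \<xi> K e"
  proof (cases "K = {}")
    case True
    then have "compact ({} :: 'a set) \<and> (1::real) > 0 \<and> pdual_nbhd \<eta> {} 1 \<subseteq> pdual_nbhd \<xi> K e"
      by (simp add: pdual_nbhd_def)
    then show ?thesis
      by (rule_tac x = "{}" in exI, rule_tac x = 1 in exI)
  next
    case False
    have "continuous_on K (\<lambda>x. cmod (pairing x \<eta> - pairing x \<xi>))"
      by (intro continuous_intros continuous_on_pairing)
    then obtain z where z: "z \<in> K"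
        "\<And>x. x \<in> K \<Longrightarrow> cmod (pairing x \<eta> - pairing x \<xi>) \<le> cmod (pairing z \<eta> - pairing z \<xi>)"
      using continuous_attains_sup[OF assms False] by blast
    define d where "d = e - cmod (pairing z \<eta> - pairing z \<xi>)"
    have "d > 0"
      using \<eta> z(1) by (simp add: d_def pdual_nbhd_def)
    moreover have "pdual_nbhd \<eta> K d \<subseteq> pdual_nbhd \<xi> K e"
      unfolding pdual_nbhd_def
    proof (intro subsetI CollectI ballI)
      fix \<zeta> x assume \<zeta>: "\<zeta> \<in> {\<zeta>. \<forall>x\<in>K. cmod (pairing x \<zeta> - pairing x \<eta>) < d}" and x: "x \<in> K"
      have "cmod (pairing x \<zeta> - pairing x \<xi>)
              \<le> cmod (pairing x \<zeta> - pairing x \<eta>) + cmod (pairing x \<eta> - pairing x \<xi>)"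
        using norm_triangle_ineq[of "pairing x \<zeta> - pairing x \<eta>" "pairing x \<eta> - pairing x \<xi>"]
        by simp
      also have "\<dots> < d + cmod (pairing z \<eta> - pairing z \<xi>)"
        using \<zeta> x z(2)[OF x] by (intro add_less_le_mono) auto
      finally show "cmod (pairing x \<zeta> - pairing x \<xi>) < e"
        by (simp add: d_def)
    qed
    ultimately show ?thesis
      using assms by (intro exI[of _ K] exI[of _ d] conjI)
  qed
qed

instance pdual :: (topological_ab_group_add) t2_space
proof
  fix \<xi> \<eta> :: "'a pdual"
  assume "\<xi> \<noteq> \<eta>"
  then obtain x where x: "pairing x \<xi> \<noteq> pairing x \<eta>"
    using pdual_eqI by blast
  define e where "e = cmod (pairing x \<xi> - pairing x \<eta>) / 2"
  have "e > 0"
    using x by (simp add: e_def)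
  have "pdual_nbhd \<xi> {x} e \<inter> pdual_nbhd \<eta> {x} e = {}"
  proof (rule ccontr)
    assume "pdual_nbhd \<xi> {x} e \<inter> pdual_nbhd \<eta> {x} e \<noteq> {}"
    then obtain \<zeta> where "cmod (pairing x \<zeta> - pairing x \<xi>) < e" "cmod (pairing x \<zeta> - pairing x \<eta>) < e"
      by (auto simp: pdual_nbhd_def)
    moreover have "cmod (pairing x \<xi> - pairing x \<eta>)
        \<le> cmod (pairing x \<zeta> - pairing x \<eta>) + cmod (pairing x \<zeta> - pairing x \<xi>)"
      using norm_triangle_ineq4[of "pairing x \<zeta> - pairing x \<eta>" "pairing x \<zeta> - pairing x \<xi>"] by simp
    ultimately show False
      by (simp add: e_def)
  qed
  moreover have "open (pdual_nbhd \<xi> {x} e)" "open (pdual_nbhd \<eta> {x} e)"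
    by (simp_all add: open_pdual_nbhd)
  moreover have "\<xi> \<in> pdual_nbhd \<xi> {x} e" "\<eta> \<in> pdual_nbhd \<eta> {x} e"
    using \<open>e > 0\<close> by (simp_all add: centre_in_pdual_nbhd)
  ultimately show "\<exists>U V. open U \<and> open V \<and> \<xi> \<in> U \<and> \<eta> \<in> V \<and> U \<inter> V = {}"
    by blast
qed

instance pdual :: (topological_ab_group_add) topological_ab_group_add
proof
  fix a b :: "'a pdual"
  show "LIM x (nhds a \<times>\<^sub>F nhds b). fst x + snd x :> nhds (a + b)"
  proof (rule topological_tendstoI)
    fix S :: "'a pdual set" assume "open S" "a + b \<in> S"
    then obtain K e where K: "compact K" and e: "e > 0" and S: "pdual_nbhd (a + b) K e \<subseteq> S"
      unfolding open_pdual_def by blast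
    have "\<xi> + \<eta> \<in> S" if "\<xi> \<in> pdual_nbhd a K (e/2)" "\<eta> \<in> pdual_nbhd b K (e/2)" for \<xi> \<eta>
    proof -
      have "cmod (pairing x (\<xi> + \<eta>) - pairing x (a + b)) < e" if "x \<in> K" for x
      proof -
        have "pairing x (\<xi> + \<eta>) - pairing x (a + b)
                = (pairing x \<xi> - pairing x a) * pairing x \<eta> + pairing x a * (pairing x \<eta> - pairing x b)"
          by (simp add: pairing_add_right algebra_simps)
        then have "cmod (pairing x (\<xi> + \<eta>) - pairing x (a + b))
                \<le> cmod (pairing x \<xi> - pairing x a) + cmod (pairing x \<eta> - pairing x b)"
          using norm_triangle_ineq[of "(pairing x \<xi> - pairing x a) * pairing x \<eta>"
                                      "pairing x a * (pairing x \<eta> - pairing x b)"]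
          by (simp add: norm_mult)
        also have "\<dots> < e / 2 + e / 2"
          using \<open>\<xi> \<in> _\<close> \<open>\<eta> \<in> _\<close> \<open>x \<in> K\<close> by (intro add_strict_mono) (auto simp: pdual_nbhd_def)
        finally show ?thesis
          by simp
      qed
      then show ?thesis
        using S by (auto simp: pdual_nbhd_def)
    qed
    moreover have "eventually (\<lambda>\<xi>. \<xi> \<in> pdual_nbhd a K (e/2)) (nhds a)"
        "eventually (\<lambda>\<eta>. \<eta> \<in> pdual_nbhd b K (e/2)) (nhds b)"
      using e by (auto intro!: eventually_nhds_in_open open_pdual_nbhd K centre_in_pdual_nbhd)
    ultimately show "eventually (\<lambda>x. fst x + snd x \<in> S) (nhds a \<times>\<^sub>F nhds b)"
      unfolding eventually_prod_filter fst_conv snd_conv by blast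
  qed
next
  fix a :: "'a pdual"
  show "(uminus \<longlongrightarrow> - a) (nhds a)"
  proof (rule topological_tendstoI)
    fix S :: "'a pdual set" assume "open S" "- a \<in> S"
    then obtain K e where K: "compact K" and e: "e > 0" and S: "pdual_nbhd (- a) K e \<subseteq> S"
      unfolding open_pdual_def by blast
    have "eventually (\<lambda>\<xi>. \<xi> \<in> pdual_nbhd a K e) (nhds a)"
      using e by (auto intro!: eventually_nhds_in_open open_pdual_nbhd K centre_in_pdual_nbhd)
    moreover have "- \<xi> \<in> S" if "\<xi> \<in> pdual_nbhd a K e" for \<xi>
      using that S
      by (auto simp: pdual_nbhd_def pairing_uminus_right simp flip: complex_cnj_diff)
    ultimately show "eventually (\<lambda>\<xi>. - \<xi> \<in> S) (nhds a)"
      by (auto elim: eventually_mono)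
  qed
qed

definition annihilator :: "'a::topological_ab_group_add set \<Rightarrow> 'a pdual set" where
  "annihilator H = {\<xi>. \<forall>h\<in>H. pairing h \<xi> = 1}"

definition add_subgroup :: "'a::group_add set \<Rightarrow> bool" where
  "add_subgroup H \<longleftrightarrow> 0 \<in> H \<and> (\<forall>x\<in>H. \<forall>y\<in>H. x + y \<in> H) \<and> (\<forall>x\<in>H. - x \<in> H)"

definition Aut :: "('a::topological_ab_group_add \<Rightarrow> 'a) set" where
  "Aut = {A. (\<forall>x y. A (x + y) = A x + A y) \<and> homeomorphism UNIV UNIV A (inv A)}"

definition adjoint_aut ::
    "('a::topological_ab_group_add \<Rightarrow> 'a) \<Rightarrow> 'a pdual \<Rightarrow> 'a pdual" where
  "adjoint_aut A \<gamma> = (THE \<delta>. \<forall>x. pairing (A x) \<gamma> = pairing x \<delta>)"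

definition zpow :: "('a \<Rightarrow> 'a) \<Rightarrow> int \<Rightarrow> 'a \<Rightarrow> 'a" where
  "zpow A n = (if n \<ge> 0 then A ^^ nat n else inv A ^^ nat (- n))"

definition expansive :: "('a::topological_ab_group_add \<Rightarrow> 'a) \<Rightarrow> 'a set \<Rightarrow> bool" where
  "expansive A H \<longleftrightarrow> H \<subset> A ` H \<and> (\<Inter>n\<in>{n. n \<le> 0}. zpow A n ` H) = {0}"

definition haar_measure :: "'a::topological_ab_group_add measure \<Rightarrow> bool" where
  "haar_measure M \<longleftrightarrow>
     sets M = sets borel \<and>
     emeasure M UNIV \<noteq> 0 \<and>
     (\<forall>K. compact K \<longrightarrow> emeasure M K < \<infinity>) \<and>
     (\<forall>B\<in>sets borel. emeasure M B = (INF U\<in>{U. open U \<and> B \<subseteq> U}. emeasure M U)) \<and>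
     (\<forall>U. open U \<longrightarrow> emeasure M U = (SUP K\<in>{K. compact K \<and> K \<subseteq> U}. emeasure M K)) \<and>
     (\<forall>x. \<forall>B\<in>sets borel. emeasure M ((+) x ` B) = emeasure M B)"

definition modulus :: "'a::topological_ab_group_add measure \<Rightarrow> ('a \<Rightarrow> 'a) \<Rightarrow> real" where
  "modulus M A = (THE c. c > 0 \<and> (\<forall>U\<in>sets borel. emeasure M (A ` U) = ennreal c * emeasure M U))"

lemma pairing_adjoint_aut:
  assumes "A \<in> Aut"
  shows "pairing x (adjoint_aut A \<gamma>) = pairing (A x) \<gamma>"
proof -
  have "continuous_on UNIV (\<lambda>x. pairing (A x) \<gamma>)"
    using assms continuous_on_compose2[OF continuous_on_pairing[of UNIV \<gamma>], of UNIV A]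
    by (auto simp: Aut_def homeomorphism_def)
  then have "char_of (Abs_pdual (\<lambda>x. pairing (A x) \<gamma>)) = (\<lambda>x. pairing (A x) \<gamma>)"
    using assms by (intro Abs_pdual_inverse) (auto simp: Aut_def pairing_add_left)
  then have *: "pairing x (Abs_pdual (\<lambda>x. pairing (A x) \<gamma>)) = pairing (A x) \<gamma>" for x
    by (metis pairing_def)
  have "adjoint_aut A \<gamma> = Abs_pdual (\<lambda>x. pairing (A x) \<gamma>)"
    unfolding adjoint_aut_def
  proof (rule the_equality)
    show "\<forall>x. pairing (A x) \<gamma> = pairing x (Abs_pdual (\<lambda>x. pairing (A x) \<gamma>))"
      using * by simp
  next
    fix \<delta> assume "\<forall>x. pairing (A x) \<gamma> = pairing x \<delta>"
    then have "pairing x \<delta> = pairing (A x) \<gamma>" for x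
      by simp
    then show "\<delta> = Abs_pdual (\<lambda>x. pairing (A x) \<gamma>)"
      by (intro pdual_eqI) (simp only: *)
  qed
  then show ?thesis
    by (simp only: *)
qed

definition Q_box ::
    "('a::topological_ab_group_add \<Rightarrow> 'a) \<Rightarrow> 'a set \<Rightarrow> int \<Rightarrow> 'a \<times> 'a pdual \<Rightarrow> ('a \<times> 'a pdual) set" where
  "Q_box A H n z =
     ((+) (fst z) ` (zpow A n ` H)) \<times> ((+) (snd z) ` (zpow (adjoint_aut A) n ` annihilator H))"

text \<open>A sequence in the time-frequency plane is an indexed family, so that points may be
  repeated; they are counted with multiplicity. Taking the index set to be a subset of the plane
  and the family to be the identity gives the case of plain sets.\<close>

definition upper_density ::
    "'a::topological_ab_group_add measure \<Rightarrow> ('a \<Rightarrow> 'a) \<Rightarrow> 'a set \<Rightarrow> 'i set \<Rightarrow> ('i \<Rightarrow> 'a \<times> 'a pdual)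
      \<Rightarrow> ennreal" where
  "upper_density M A H I \<Lambda> =
     limsup (\<lambda>n::nat. (SUP z. emeasure (count_space UNIV) {i\<in>I. \<Lambda> i \<in> Q_box A H (int n) z})
                        / ennreal (modulus M A ^ (2 * n)))"

text \<open>Elements of L2 are represented by functions; being zero means being zero almost
  everywhere.\<close>

definition L2 :: "'a measure \<Rightarrow> ('a \<Rightarrow> complex) set" where
  "L2 M = {f \<in> borel_measurable M. integrable M (\<lambda>x. (cmod (f x))\<^sup>2)}"

definition L2_inner :: "'a measure \<Rightarrow> ('a \<Rightarrow> complex) \<Rightarrow> ('a \<Rightarrow> complex) \<Rightarrow> complex" where
  "L2_inner M f g = (\<integral>x. f x * cnj (g x) \<partial>M)"

definition nonzero_L2 :: "'a measure \<Rightarrow> ('a \<Rightarrow> complex) \<Rightarrow> bool" where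
  "nonzero_L2 M f \<longleftrightarrow> \<not> (AE x in M. f x = 0)"

definition Bessel_sequence :: "'a measure \<Rightarrow> 'i set \<Rightarrow> ('i \<Rightarrow> 'a \<Rightarrow> complex) \<Rightarrow> bool" where
  "Bessel_sequence M I \<phi> \<longleftrightarrow>
     (\<forall>i\<in>I. \<phi> i \<in> L2 M) \<and>
     (\<exists>B>0. \<forall>f\<in>L2 M.
        (\<Sum>\<^sub>\<infinity>i\<in>I. ennreal ((cmod (L2_inner M f (\<phi> i)))\<^sup>2)) \<le> ennreal (B * (\<integral>x. (cmod (f x))\<^sup>2 \<partial>M)))"

definition translation :: "'a::topological_ab_group_add \<Rightarrow> ('a \<Rightarrow> complex) \<Rightarrow> 'a \<Rightarrow> complex" where
  "translation x f = (\<lambda>y. f (y - x))"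

definition modulation :: "'a::topological_ab_group_add pdual \<Rightarrow> ('a \<Rightarrow> complex) \<Rightarrow> 'a \<Rightarrow> complex" where
  "modulation \<xi> f = (\<lambda>y. pairing y \<xi> * f y)"

definition time_frequency_shift ::
    "'a::topological_ab_group_add \<times> 'a pdual \<Rightarrow> ('a \<Rightarrow> complex) \<Rightarrow> 'a \<Rightarrow> complex" where
  "time_frequency_shift z f = modulation (snd z) (translation (fst z) f)"

definition gabor_system ::
    "('a::topological_ab_group_add \<Rightarrow> complex) \<Rightarrow> ('i \<Rightarrow> 'a \<times> 'a pdual) \<Rightarrow> 'i \<Rightarrow> 'a \<Rightarrow> complex" where
  "gabor_system \<phi> \<Lambda> = (\<lambda>i. time_frequency_shift (\<Lambda> i) \<phi>)"

definition STFT ::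
    "'a::topological_ab_group_add measure \<Rightarrow> ('a \<Rightarrow> complex) \<Rightarrow> ('a \<Rightarrow> complex) \<Rightarrow> 'a \<times> 'a pdual \<Rightarrow> complex"
  where "STFT M g f z = L2_inner M f (time_frequency_shift z g)"

text \<open>Integrability below is for the product of the two Haar measures. When an automorphism and its
  adjoint are both expansive, the group and its dual are second countable, so the product
  sigma-algebra is the Borel sigma-algebra and the product measure is the Haar measure of the
  time-frequency plane.\<close>

definition admissible_window ::
    "'a::topological_ab_group_add measure \<Rightarrow> 'a pdual measure \<Rightarrow> ('a \<Rightarrow> complex) \<Rightarrow> bool" where
  "admissible_window M N g \<longleftrightarrow> g \<in> L2 M \<and> nonzero_L2 M g \<and> integrable (M \<Otimes>\<^sub>M N) (STFT M g g)"

definition modulation_space_M1 ::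
    "'a::topological_ab_group_add measure \<Rightarrow> 'a pdual measure \<Rightarrow> ('a \<Rightarrow> complex) \<Rightarrow> ('a \<Rightarrow> complex) set"
  where "modulation_space_M1 M N g = {f \<in> L2 M. integrable (M \<Otimes>\<^sub>M N) (STFT M g f)}"

end

theory Submission
  imports Defs
begin

text \<open>
  Write \<open>\<chi>\<close> for the indicator of \<open>H\<close>, \<open>\<pi>(z)\<close> for the time-frequency shift by \<open>z\<close>, and \<open>L\<close> for
  the product of \<open>H\<close> with its annihilator. The atoms \<open>\<pi>(z)\<chi>\<close> depend, up to a phase, only on the
  coset of \<open>z\<close> modulo \<open>L\<close>, and over a transversal \<open>(t\<^sub>n)\<close> of the cosets they are orthonormal.
  The theorem holds because a window in the modulation space is an absolutely summable
  combination of atoms, while a family of points of finite density meets every coset of \<open>L\<close> a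
  bounded number of times.

  In detail, let \<open>\<phi> = \<Sum>\<^sub>n c\<^sub>n \<pi>(t\<^sub>n)\<chi>\<close>. Since \<open>\<pi>(\<lambda>)\<pi>(t)\<chi>\<close> is a phase times \<open>\<pi>(\<lambda> + t)\<chi>\<close>, the
  number \<open>\<langle>f, \<pi>(\<lambda>)\<phi>\<rangle>\<close> is a sum of terms of size \<open>|c\<^sub>n| |\<langle>f, \<pi>(\<lambda> + t\<^sub>n)\<chi>\<rangle>|\<close>. If every coset of \<open>L\<close>
  contains at most \<open>C\<close> of the points, then Bessel's inequality for the atoms gives
  \<open>\<Sum>\<^sub>i |\<langle>f, \<pi>(\<lambda>\<^sub>i + t\<^sub>n)\<chi>\<rangle>|\<^sup>2 \<le> C \<parallel>f\<parallel>\<^sup>2\<close> for each \<open>n\<close> (\<open>atom_samples_bound\<close>), and the triangle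
  inequality yields the Bessel bound \<open>C (\<Sum>\<^sub>n |c\<^sub>n|)\<^sup>2\<close> (\<open>gabor_samples_bound\<close>). Finite upper density
  provides \<open>C\<close> because the boxes of nonnegative size contain the cosets of \<open>L\<close>.

  The coefficients are summable for the following reason (\<open>coefficient_bound\<close>). Integrating
  the short-time Fourier transform of \<open>\<phi>\<close> with window \<open>g\<close>, multiplied by suitable phases, over the
  coset of \<open>w - z\<close> gives the product of \<open>\<langle>\<phi>, \<pi>(w)\<chi>\<rangle>\<close> with the conjugate of \<open>\<langle>g, \<pi>(z)\<chi>\<rangle>\<close>. For
  fixed \<open>z\<close> with \<open>\<langle>g, \<pi>(z)\<chi>\<rangle> \<noteq> 0\<close> these cosets are disjoint as \<open>w\<close> runs through the transversal, so
  the sum of the coefficients is at most a constant times the integral of the transform.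

  What remains is that the atoms are complete (\<open>atoms_complete\<close>), both to find \<open>z\<close> and to expand
  \<open>\<phi>\<close>. Expansiveness makes the subgroups \<open>A\<^sup>-\<^sup>nH\<close> a neighbourhood base of 0. The characters of the
  finite group \<open>H / A\<^sup>-\<^sup>nH\<close> sum to a multiple of the indicator of \<open>A\<^sup>-\<^sup>nH\<close>, so a function orthogonal to
  all atoms has integral zero over all cosets of these subgroups, which generate the Borel sets.
  That there are enough characters follows from the divisibility of the circle and Zorn's lemma
  (\<open>open_subgroup_separated_by_character\<close>). Finally, expansiveness of the adjoint shows that the
  compact sets \<open>A\<^sup>nH\<close> exhaust the group, and the absence of small subgroups of the circle that the
  annihilators of the \<open>A\<^sup>-\<^sup>nH\<close> exhaust the dual. Hence all families of cosets are countable, both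
  Haar measures are sigma-finite, and the integrals over the plane can be iterated.
\<close>

section \<open>Cosets of open subgroups\<close>

definition coset :: "'a::ab_group_add set \<Rightarrow> 'a \<Rightarrow> 'a set" where
  "coset S a = {y. y - a \<in> S}"

lemma open_coset:
  fixes S :: "'a::topological_ab_group_add set"
  assumes "open S"
  shows "open (coset S a)"
proof -
  have "continuous_on UNIV (\<lambda>y. y - a)" by (intro continuous_intros)
  then have "open ((\<lambda>y. y - a) -` S)" using assms by (simp add: open_vimage)
  then show ?thesis by (simp add: vimage_def coset_def)
qed

lemma add_subgroupD:
  assumes "add_subgroup S"
  shows "0 \<in> S" "x \<in> S \<Longrightarrow> y \<in> S \<Longrightarrow> x + y \<in> S" "x \<in> S \<Longrightarrow> - x \<in> S"
  using assms by (auto simp: add_subgroup_def)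

lemma add_subgroup_diff: "add_subgroup S \<Longrightarrow> x \<in> S \<Longrightarrow> y \<in> S \<Longrightarrow> x - y \<in> S"
  using add_subgroupD(2)[of S x "- y"] add_subgroupD(3)[of S y] by simp

lemma coset_eq:
  assumes "add_subgroup S" "a - b \<in> S"
  shows "coset S a = coset S b"
proof -
  have "y - a \<in> S \<longleftrightarrow> y - b \<in> S" for y
    using add_subgroup_diff[OF assms(1), of "y - b" "a - b"]
      add_subgroupD(2)[OF assms(1), of "y - a" "a - b"] assms(2) by auto
  then show ?thesis by (simp add: coset_def)
qed

lemma coset_self: "add_subgroup S \<Longrightarrow> a \<in> coset S a"
  by (simp add: coset_def add_subgroup_def)

lemma image_add_eq_coset: "(+) a ` S = coset S a"
proof (intro equalityI subsetI)
  fix y assume "y \<in> coset S a"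
  then have "y = a + (y - a)" "y - a \<in> S" by (simp_all add: coset_def)
  then show "y \<in> (+) a ` S" by (rule image_eqI)
qed (auto simp: coset_def)

lemma compact_covered_by_finitely_many_cosets:
  fixes S :: "'a::topological_ab_group_add set"
  assumes "compact K" "add_subgroup S" "open S"
  shows "\<exists>R. finite R \<and> K \<subseteq> (\<Union>r\<in>R. coset S r)"
proof -
  have "K \<subseteq> (\<Union>r\<in>K. coset S r)"
    using coset_self[OF assms(2)] by (intro subsetI UN_I)
  then obtain R where "R \<subseteq> K" "finite R" "K \<subseteq> (\<Union>r\<in>R. coset S r)"
    by (rule compactE_image[OF assms(1) open_coset[OF assms(3)]])
  then show ?thesis by (intro exI conjI)
qed

text \<open>A label that is constant precisely on the cosets, if \<^term>\<open>r\<close>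
  enumerates representatives of all of them. Repetitions in \<^term>\<open>r\<close> are
  harmless because the first match counts.\<close>

definition coset_index :: "'a::ab_group_add set \<Rightarrow> (nat \<Rightarrow> 'a) \<Rightarrow> 'a \<Rightarrow> nat" where
  "coset_index S r x = (LEAST k. x \<in> coset S (r k))"

lemma coset_index:
  assumes "(\<Union>k. coset S (r k)) = UNIV"
  shows "x - r (coset_index S r x) \<in> S"
proof -
  have "\<exists>k. x \<in> coset S (r k)" using assms by blast
  from LeastI_ex[OF this] show ?thesis by (simp add: coset_index_def coset_def)
qed

lemma coset_index_eq:
  assumes S: "add_subgroup S" and "x - y \<in> S"
  shows "coset_index S r x = coset_index S r y"
proof -
  have "x \<in> coset S (r k) \<longleftrightarrow> y \<in> coset S (r k)" for k
    using add_subgroup_diff[OF S, of "x - r k" "x - y"]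
      add_subgroupD(2)[OF S, of "y - r k" "x - y"] assms(2) by (auto simp: coset_def)
  then show ?thesis by (simp add: coset_index_def)
qed

lemma coset_index_cong_iff:
  assumes S: "add_subgroup S" and r: "(\<Union>k. coset S (r k)) = UNIV"
  shows "coset_index S r x = coset_index S r y \<longleftrightarrow> x - y \<in> S"
proof
  assume eq: "coset_index S r x = coset_index S r y"
  show "x - y \<in> S"
    using add_subgroup_diff[OF S coset_index[OF r, of x] coset_index[OF r, of y]] by (simp add: eq)
qed (rule coset_index_eq[OF S])

text \<open>The label is locally constant, so that every preimage is open.\<close>

lemma measurable_coset_index:
  fixes S :: "'a::topological_ab_group_add set"
  assumes S: "add_subgroup S" "open S"
  shows "coset_index S r \<in> measurable borel (count_space UNIV)"
proof -
  have "open (coset_index S r -` X)" for X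
  proof -
    have "coset_index S r -` X = (\<Union>a\<in>coset_index S r -` X. coset S a)"
    proof (intro equalityI subsetI)
      fix y assume "y \<in> coset_index S r -` X"
      then show "y \<in> (\<Union>a\<in>coset_index S r -` X. coset S a)"
        using coset_self[OF S(1)] by blast
    next
      fix y assume "y \<in> (\<Union>a\<in>coset_index S r -` X. coset S a)"
      then obtain a where a: "coset_index S r a \<in> X" "y - a \<in> S" by (auto simp: coset_def)
      then show "y \<in> coset_index S r -` X"
        using coset_index_eq[OF S(1) a(2), of r] by simp
    qed
    then show ?thesis
      by (metis (no_types, lifting) open_UN open_coset[OF S(2)])
  qed
  then show ?thesis
    by (intro measurableI) auto
qed

section \<open>Extension of characters\<close>

text \<open>The graph of a homomorphism from a subgroup into the unit circle. Graphs are ordered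
  by inclusion and are closed under unions of chains, which suits Zorn's lemma.\<close>

definition partial_character :: "('a::ab_group_add \<times> complex) set \<Rightarrow> bool" where
  "partial_character R \<longleftrightarrow>
     (0, 1) \<in> R \<and>
     (\<forall>x c y d. (x, c) \<in> R \<longrightarrow> (y, d) \<in> R \<longrightarrow> (x + y, c * d) \<in> R) \<and>
     (\<forall>x c. (x, c) \<in> R \<longrightarrow> (- x, cnj c) \<in> R) \<and>
     (\<forall>x c. (x, c) \<in> R \<longrightarrow> cmod c = 1) \<and>
     (\<forall>c. (0, c) \<in> R \<longrightarrow> c = 1)"

lemma partial_characterD:
  assumes "partial_character R"
  shows "(0, 1) \<in> R"
    and "(x, c) \<in> R \<Longrightarrow> (y, d) \<in> R \<Longrightarrow> (x + y, c * d) \<in> R"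
    and "(x, c) \<in> R \<Longrightarrow> (- x, cnj c) \<in> R"
    and "(x, c) \<in> R \<Longrightarrow> cmod c = 1"
    and "(0, c) \<in> R \<Longrightarrow> c = 1"
  using assms unfolding partial_character_def by blast+

lemma unimodular_cnj: "cmod c = 1 \<Longrightarrow> cnj c * c = 1"
  using complex_norm_square[of c] by (simp add: mult.commute)

lemma partial_character_unique:
  assumes R: "partial_character R" and "(x, c) \<in> R" "(x, d) \<in> R"
  shows "c = d"
proof -
  have "(x + - x, c * cnj d) \<in> R"
    using assms partial_characterD[OF R] by blast
  then have "c * cnj d = 1"
    using partial_characterD(5)[OF R] by simp
  moreover have "cnj d * d = 1"
    using partial_characterD(4)[OF R assms(3)] by (rule unimodular_cnj)
  ultimately show ?thesis
    by (metis mult.assoc mult.commute mult_1)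
qed

primrec nsmul :: "nat \<Rightarrow> 'a::ab_group_add \<Rightarrow> 'a" where
  "nsmul 0 x = 0"
| "nsmul (Suc n) x = x + nsmul n x"

lemma nsmul_add: "nsmul (m + n) x = nsmul m x + nsmul n x"
  by (induction m) (auto simp: algebra_simps)

lemma nsmul_diff: "m \<le> n \<Longrightarrow> nsmul (n - m) x = nsmul n x - nsmul m x"
  using nsmul_add[of m "n - m" x] by simp

text \<open>The only obstruction to prescribing the value \<^term>\<open>c\<close> at
  \<^term>\<open>x\<close> is that multiples of \<^term>\<open>x\<close> may already have a
  value.\<close>

lemma partial_character_adjoin:
  assumes R: "partial_character R" and c: "cmod c = 1"
    and compat: "\<And>n d. (nsmul n x, d) \<in> R \<Longrightarrow> d = c ^ n"
  shows "\<exists>R'. partial_character R' \<and> R \<subseteq> R' \<and> (x, c) \<in> R'"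
proof (intro exI conjI)
  define R' where
    "R' = {(y + nsmul n x - nsmul m x, d * c ^ n * cnj c ^ m) | y d n m. (y, d) \<in> R}"
  have c1: "cnj c ^ n * c ^ n = 1" for n
    using unimodular_cnj[OF c] by (simp flip: power_mult_distrib)
  have kernel: "w = 1" if w: "(0, w) \<in> R'" for w
  proof -
    obtain y d n m where 0: "y + nsmul n x - nsmul m x = 0" and w: "w = d * c ^ n * cnj c ^ m"
      and yd: "(y, d) \<in> R"
      using w by (auto simp: R'_def)
    have d: "cnj d * d = 1"
      using partial_characterD(4)[OF R yd] by (rule unimodular_cnj)
    show "w = 1"
    proof (cases "m \<le> n")
      case True
      have "nsmul (n - m) x = - y"
        using 0 minus_unique[of y "nsmul (n - m) x"] by (simp add: nsmul_diff[OF True] add_diff_eq)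
      then have "cnj d = c ^ (n - m)"
        using compat partial_characterD(3)[OF R yd] by metis
      moreover have "c ^ n = c ^ (n - m) * c ^ m"
        using True by (simp flip: power_add)
      ultimately have "w = (cnj d * d) * (cnj c ^ m * c ^ m)"
        unfolding w by (simp add: mult_ac)
      then show ?thesis using d c1 by simp
    next
      case False
      then have "n \<le> m" by simp
      have "nsmul (m - n) x = y"
        using 0 by (simp add: nsmul_diff[OF \<open>n \<le> m\<close>] algebra_simps)
      then have d: "d = c ^ (m - n)"
        using compat yd by metis
      have "d * c ^ n = c ^ m"
        unfolding d using \<open>n \<le> m\<close> by (simp flip: power_add)
      then show ?thesis using c1[of m] w by (simp add: mult.commute)
    qed
  qed
  have add: "(u + v, a * b) \<in> R'" if "(u, a) \<in> R'" "(v, b) \<in> R'" for u v a b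
  proof -
    obtain y d n m where u: "u = y + nsmul n x - nsmul m x" "a = d * c ^ n * cnj c ^ m" "(y, d) \<in> R"
      using \<open>(u, a) \<in> R'\<close> by (auto simp: R'_def)
    obtain y' d' n' m' where v: "v = y' + nsmul n' x - nsmul m' x" "b = d' * c ^ n' * cnj c ^ m'"
        "(y', d') \<in> R"
      using \<open>(v, b) \<in> R'\<close> by (auto simp: R'_def)
    have "u + v = (y + y') + nsmul (n + n') x - nsmul (m + m') x"
      "a * b = (d * d') * c ^ (n + n') * cnj c ^ (m + m')"
      by (simp_all add: u v nsmul_add power_add algebra_simps)
    moreover have "(y + y', d * d') \<in> R"
      using u v partial_characterD(2)[OF R] by blast
    ultimately show ?thesis
      unfolding R'_def by blast
  qed
  have minus: "(- u, cnj a) \<in> R'" if "(u, a) \<in> R'" for u a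
  proof -
    obtain y d n m where u: "u = y + nsmul n x - nsmul m x" "a = d * c ^ n * cnj c ^ m" "(y, d) \<in> R"
      using \<open>(u, a) \<in> R'\<close> by (auto simp: R'_def)
    have "- u = - y + nsmul m x - nsmul n x" "cnj a = cnj d * c ^ m * cnj c ^ n"
      by (simp_all add: u algebra_simps)
    moreover have "(- y, cnj d) \<in> R"
      using u partial_characterD(3)[OF R] by blast
    ultimately show ?thesis
      unfolding R'_def by blast
  qed
  have norm: "cmod a = 1" if "(u, a) \<in> R'" for u a
    using that c partial_characterD(4)[OF R] by (auto simp: R'_def norm_mult norm_power)
  have sub: "R \<subseteq> R'"
  proof
    fix p assume p: "p \<in> R"
    obtain y d where "p = (y, d)" by force
    moreover have "(y, d) = (y + nsmul 0 x - nsmul 0 x, d * c ^ 0 * cnj c ^ 0)" by simp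
    ultimately show "p \<in> R'" using p unfolding R'_def by blast
  qed
  show "partial_character R'"
    unfolding partial_character_def
    using kernel add minus norm sub partial_characterD(1)[OF R] by blast
  show "R \<subseteq> R'" by fact
  have "(x, c) = (0 + nsmul 1 x - nsmul 0 x, 1 * c ^ 1 * cnj c ^ 0)"
    by simp
  then show "(x, c) \<in> R'"
    using partial_characterD(1)[OF R] unfolding R'_def by blast
qed

text \<open>The multiples of \<^term>\<open>x\<close> in the domain are those of the smallest
  positive one, so only that one constrains the value at \<^term>\<open>x\<close>.\<close>

lemma compatible_root:
  assumes R: "partial_character R" and m: "m > 0" "(nsmul m x, d) \<in> R" and c: "c ^ m = d"
    and min: "\<And>k e. 0 < k \<Longrightarrow> k < m \<Longrightarrow> (nsmul k x, e) \<notin> R"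
  shows "(nsmul n x, e) \<in> R \<Longrightarrow> e = c ^ n"
proof (induction n arbitrary: e rule: less_induct)
  case (less n)
  consider "n = 0" | "0 < n" "n < m" | "m \<le> n" by linarith
  then show ?case
  proof cases
    case 1
    then show ?thesis using less.prems partial_characterD(5)[OF R] by simp
  next
    case 2
    then show ?thesis using less.prems min by blast
  next
    case 3
    have "(nsmul n x + - nsmul m x, e * cnj d) \<in> R"
      using less.prems m partial_characterD[OF R] by blast
    then have "(nsmul (n - m) x, e * cnj d) \<in> R"
      using 3 by (simp add: nsmul_diff)
    then have "e * cnj d = c ^ (n - m)"
      using less.IH[of "n - m"] m 3 by simp
    moreover have "c ^ n = c ^ (n - m) * d"
      using 3 by (simp flip: c power_add)
    moreover have "cnj d * d = 1"
      using partial_characterD(4)[OF R m(2)] by (rule unimodular_cnj)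
    ultimately show ?thesis by (metis mult.assoc mult.right_neutral)
  qed
qed

text \<open>The circle is divisible, so the constraint on the value at \<^term>\<open>x\<close>
  can be met. The last clause is what later separates points: the order of
  \<^term>\<open>x\<close> modulo the domain is infinite or at least 2, so where only the value
  1 occurs so far, a value other than 1 is available.\<close>

lemma compatible_value_exists:
  assumes R: "partial_character R" and x: "x \<notin> Domain R"
  shows "\<exists>c. cmod c = 1 \<and> (\<forall>n d. (nsmul n x, d) \<in> R \<longrightarrow> d = c ^ n) \<and>
             ((\<forall>(y, d)\<in>R. d = 1) \<longrightarrow> c \<noteq> 1)"
proof (cases "\<exists>m>0. nsmul m x \<in> Domain R")
  case False
  have "d = (-1) ^ n" if d: "(nsmul n x, d) \<in> R" for n d
  proof (cases n)
    case 0
    then show ?thesis using d partial_characterD(5)[OF R] by simp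
  next
    case (Suc k)
    then show ?thesis using d False by blast
  qed
  \<comment> \<open>no positive multiple has a value yet, so any value other than 1 will do\<close>
  then show ?thesis by (intro exI[of _ "-1"]) simp
next
  case True
  define m where "m = (LEAST m. m > 0 \<and> nsmul m x \<in> Domain R)"
  have m: "m > 0" "nsmul m x \<in> Domain R"
    using LeastI_ex[OF True] by (auto simp: m_def)
  have min: "(nsmul k x, e) \<notin> R" if "0 < k" "k < m" for k e
    using not_less_Least[OF that(2)[unfolded m_def]] that(1) by blast
  obtain d where d: "(nsmul m x, d) \<in> R"
    using m by blast
  have "m \<noteq> 1"
    using m x by auto
  obtain c where c: "c ^ m = d" and c1: "d = 1 \<longrightarrow> c \<noteq> 1"
  proof (cases "d = 1")
    case True
    have "card {z::complex. z ^ m = 1} = m"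
      using m by (intro card_roots_unity_eq) auto
    then have "\<not> {z::complex. z ^ m = 1} \<subseteq> {1}"
      using card_mono[of "{1::complex}" "{z. z ^ m = 1}"] m \<open>m \<noteq> 1\<close> by auto
    then show ?thesis using that True by blast
  next
    case False
    then show ?thesis using that exists_complex_root[of m d] m by auto
  qed
  have "cmod c ^ m = 1 ^ m"
    using partial_characterD(4)[OF R d] c by (metis norm_power power_one)
  then have "cmod c = 1"
    by (rule power_eq_imp_eq_base) (use m(1) in simp_all)
  moreover have "\<forall>n d. (nsmul n x, d) \<in> R \<longrightarrow> d = c ^ n"
    using compatible_root[OF R m(1) d c min] by blast
  moreover have "(\<forall>(y, d)\<in>R. d = 1) \<longrightarrow> c \<noteq> 1"
    using d c1 by blast
  ultimately show ?thesis by blast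
qed

text \<open>By Zorn's lemma there is a maximal partial character, and adjoining one more element
  shows that its domain is everything.\<close>

lemma partial_character_total_extension:
  assumes R: "partial_character R"
  shows "\<exists>\<theta>. (\<forall>x y. \<theta> (x + y) = \<theta> x * \<theta> y) \<and> (\<forall>x. cmod (\<theta> x) = 1) \<and> (\<forall>(x, c)\<in>R. \<theta> x = c)"
proof -
  let ?F = "{R'. partial_character R' \<and> R \<subseteq> R'}"
  have "\<exists>P\<in>?F. \<forall>X\<in>?F. P \<subseteq> X \<longrightarrow> X = P"
  proof (rule subset_Zorn_nonempty)
    show "?F \<noteq> {}" using R by blast
    fix C assume "C \<noteq> {}" and C: "subset.chain ?F C"
    then have F: "\<And>X. X \<in> C \<Longrightarrow> partial_character X \<and> R \<subseteq> X"
      and lin: "\<And>X Y. X \<in> C \<Longrightarrow> Y \<in> C \<Longrightarrow> X \<subseteq> Y \<or> Y \<subseteq> X"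
      by (auto simp: subset_chain_def)
    have add: "(x + y, c * d) \<in> \<Union>C" if "(x, c) \<in> \<Union>C" "(y, d) \<in> \<Union>C" for x y c d
    proof -
      obtain X Y where XY: "X \<in> C" "Y \<in> C" "(x, c) \<in> X" "(y, d) \<in> Y"
        using \<open>(x, c) \<in> \<Union>C\<close> \<open>(y, d) \<in> \<Union>C\<close> by blast
      then obtain Z where "Z \<in> C" "(x, c) \<in> Z" "(y, d) \<in> Z"
        using lin[OF XY(1,2)] by blast
      then show ?thesis
        using F partial_characterD(2) by blast
    qed
    have "partial_character (\<Union>C)"
      unfolding partial_character_def
    proof (intro conjI)
      show "(0, 1) \<in> \<Union>C"
        using F \<open>C \<noteq> {}\<close> partial_characterD(1) by blast
      show "\<forall>x c y d. (x, c) \<in> \<Union>C \<longrightarrow> (y, d) \<in> \<Union>C \<longrightarrow> (x + y, c * d) \<in> \<Union>C"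
        using add by blast
      show "\<forall>x c. (x, c) \<in> \<Union>C \<longrightarrow> (- x, cnj c) \<in> \<Union>C"
        using F partial_characterD(3) by blast
      show "\<forall>x c. (x, c) \<in> \<Union>C \<longrightarrow> cmod c = 1"
        using F partial_characterD(4) by blast
      show "\<forall>c. (0, c) \<in> \<Union>C \<longrightarrow> c = 1"
        using F partial_characterD(5) by blast
    qed
    then show "\<Union>C \<in> ?F"
      using F \<open>C \<noteq> {}\<close> by blast
  qed
  then obtain P where "P \<in> ?F" and maxF: "\<forall>X\<in>?F. P \<subseteq> X \<longrightarrow> X = P"
    by (elim bexE)
  then have P: "partial_character P" and "R \<subseteq> P"
    by simp_all
  have max: "X = P" if "partial_character X" "P \<subseteq> X" for X
    using maxF that \<open>R \<subseteq> P\<close> by auto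
  have "x \<in> Domain P" for x
  proof (rule ccontr)
    assume x: "x \<notin> Domain P"
    from compatible_value_exists[OF P x]
    obtain c where c: "cmod c = 1" "\<And>n d. (nsmul n x, d) \<in> P \<Longrightarrow> d = c ^ n" by blast
    from partial_character_adjoin[OF P c]
    obtain R' where "partial_character R'" "P \<subseteq> R'" "(x, c) \<in> R'" by blast
    then show False using max x by blast
  qed
  then have "\<forall>x. \<exists>c. (x, c) \<in> P"
    by (simp add: Domain_iff)
  then obtain \<theta> where \<theta>: "\<And>x. (x, \<theta> x) \<in> P"
    by (auto dest!: choice)
  have "\<theta> (x + y) = \<theta> x * \<theta> y" for x y
    using partial_character_unique[OF P \<theta>] partial_characterD(2)[OF P \<theta> \<theta>] by blast
  moreover have "cmod (\<theta> x) = 1" for x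
    using partial_characterD(4)[OF P \<theta>] .
  moreover have "\<forall>(x, c)\<in>R. \<theta> x = c"
    using partial_character_unique[OF P \<theta>] \<open>R \<subseteq> P\<close> by blast
  ultimately show ?thesis by blast
qed

text \<open>A homomorphism that is trivial on an open subgroup is locally constant, so the
  purely algebraic extension is automatically continuous. This supplies all the characters that
  the proof needs.\<close>

theorem open_subgroup_separated_by_character:
  fixes S :: "'a::topological_ab_group_add set"
  assumes S: "add_subgroup S" "open S" and x: "x \<notin> S"
  shows "\<exists>\<xi>\<in>annihilator S. pairing x \<xi> \<noteq> 1"
proof -
  define R where "R = S \<times> {1::complex}"
  have R: "partial_character R"
    using S(1) unfolding partial_character_def R_def add_subgroup_def by simp
  have x': "x \<notin> Domain R" and R1: "\<forall>(y, d)\<in>R. d = 1"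
    using x by (auto simp: R_def)
  obtain c where c0: "cmod c = 1" "\<forall>n d. (nsmul n x, d) \<in> R \<longrightarrow> d = c ^ n"
      "(\<forall>(y, d)\<in>R. d = 1) \<longrightarrow> c \<noteq> 1"
    using compatible_value_exists[OF R x'] by (elim exE conjE)
  then have c: "cmod c = 1" "\<And>n d. (nsmul n x, d) \<in> R \<Longrightarrow> d = c ^ n" "c \<noteq> 1"
    using R1 by simp_all
  from partial_character_adjoin[OF R c(1,2)]
  obtain R' where R': "partial_character R'" "R \<subseteq> R'" "(x, c) \<in> R'" by blast
  from partial_character_total_extension[OF R'(1)]
  obtain \<theta> where \<theta>0: "\<forall>x y. \<theta> (x + y) = \<theta> x * \<theta> y" "\<forall>x. cmod (\<theta> x) = 1"
    "\<forall>(x, c)\<in>R'. \<theta> x = c" by (elim exE conjE)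
  then have \<theta>: "\<And>x y. \<theta> (x + y) = \<theta> x * \<theta> y" "\<And>x. cmod (\<theta> x) = 1"
    "\<And>x c. (x, c) \<in> R' \<Longrightarrow> \<theta> x = c" by auto
  have \<theta>S: "\<theta> s = 1" if "s \<in> S" for s
    using \<theta>(3) R'(2) that by (auto simp: R_def)
  have "continuous_on UNIV \<theta>"
    unfolding continuous_on_open_vimage[OF open_UNIV]
  proof (intro allI impI)
    fix B :: "complex set"
    have "\<theta> -` B = (\<Union>a\<in>\<theta> -` B. coset S a)"
    proof (intro equalityI subsetI)
      fix y assume "y \<in> \<theta> -` B"
      then show "y \<in> (\<Union>a\<in>\<theta> -` B. coset S a)"
        using add_subgroupD(1)[OF S(1)] by (intro UN_I[of y]) (auto simp: coset_def)
    next
      fix y assume "y \<in> (\<Union>a\<in>\<theta> -` B. coset S a)"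
      then obtain a where "\<theta> a \<in> B" "y - a \<in> S" by (auto simp: coset_def)
      then have "\<theta> (a + (y - a)) = \<theta> a" using \<theta>(1)[of a "y - a"] \<theta>S by simp
      then show "y \<in> \<theta> -` B" using \<open>\<theta> a \<in> B\<close> by simp
    qed
    then have "open (\<theta> -` B)"
      by (metis (no_types, lifting) open_UN open_coset[OF S(2)])
    then show "open (\<theta> -` B \<inter> UNIV)" by simp
  qed
  then have "char_of (Abs_pdual \<theta>) = \<theta>"
    using \<theta> by (intro Abs_pdual_inverse) auto
  then have p: "pairing y (Abs_pdual \<theta>) = \<theta> y" for y
    by (simp add: pairing_def)
  show ?thesis
    using \<theta>S \<theta>(3)[OF R'(3)] c(3) by (intro bexI[of _ "Abs_pdual \<theta>"]) (auto simp: p annihilator_def)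
qed

section \<open>The filtration by an expansive automorphism\<close>

locale expansive_group =
  fixes A :: "'a::{topological_ab_group_add, t2_space} \<Rightarrow> 'a" and H :: "'a set"
  assumes H_subgroup: "add_subgroup H" and H_compact: "compact H" and H_open: "open H"
    and A_Aut: "A \<in> Aut" and A_expansive: "expansive A H"
    and A_adjoint_expansive: "expansive (adjoint_aut A) (annihilator H)"
begin

definition core :: "nat \<Rightarrow> 'a set" where "core n = (inv A ^^ n) ` H"
definition dilate :: "nat \<Rightarrow> 'a set" where "dilate n = (A ^^ n) ` H"

lemma A_add: "A (x + y) = A x + A y"
  using A_Aut by (simp add: Aut_def)

lemma A_minus: "A (- x) = - A x"
proof -
  have "A (0 + 0) = A 0 + A 0" by (rule A_add)
  then have "A 0 = 0" by simp
  moreover have "A (x + - x) = A x + A (- x)" by (rule A_add)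
  ultimately show ?thesis by (simp add: eq_neg_iff_add_eq_0 add.commute)
qed

lemma A_homeomorphism: "homeomorphism UNIV UNIV A (inv A)"
  using A_Aut by (simp add: Aut_def)

lemma inv_A [simp]: "inv A (A x) = x" "A (inv A x) = x"
  using A_homeomorphism by (simp_all add: homeomorphism_def)

lemma inv_A_pow [simp]: "(inv A ^^ n) ((A ^^ n) x) = x" "(A ^^ n) ((inv A ^^ n) x) = x"
  by (induction n arbitrary: x) (simp_all add: funpow_swap1)

lemma A_pow_add: "(A ^^ n) (x + y) = (A ^^ n) x + (A ^^ n) y"
  by (induction n) (simp_all add: A_add)

lemma A_pow_minus: "(A ^^ n) (- x) = - (A ^^ n) x"
  by (induction n) (simp_all add: A_minus)

lemma A_pow_continuous: "continuous_on S (A ^^ n)" "continuous_on S (inv A ^^ n)"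
proof -
  have A: "continuous_on UNIV A" "continuous_on UNIV (inv A)"
    using A_homeomorphism by (simp_all add: homeomorphism_def)
  have "continuous_on UNIV (f ^^ n)" if "continuous_on UNIV f" for f :: "'a \<Rightarrow> 'a"
  proof (induction n)
    case (Suc n)
    show ?case
      using continuous_on_compose2[OF that Suc.IH] by (simp add: comp_def)
  qed (simp add: id_def)
  then show "continuous_on S (A ^^ n)" "continuous_on S (inv A ^^ n)"
    using A continuous_on_subset by blast+
qed

lemma core_vimage: "core n = (A ^^ n) -` H"
proof (intro equalityI subsetI)
  fix x assume "x \<in> (A ^^ n) -` H"
  then have "(inv A ^^ n) ((A ^^ n) x) \<in> core n" unfolding core_def by (intro imageI) simp
  then show "x \<in> core n" by simp
qed (auto simp: core_def)

lemma dilate_vimage: "dilate n = (inv A ^^ n) -` H"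
proof (intro equalityI subsetI)
  fix x assume "x \<in> (inv A ^^ n) -` H"
  then have "(A ^^ n) ((inv A ^^ n) x) \<in> dilate n" unfolding dilate_def by (intro imageI) simp
  then show "x \<in> dilate n" by simp
qed (auto simp: dilate_def)

lemma core_0 [simp]: "core 0 = H" and dilate_0 [simp]: "dilate 0 = H"
  by (simp_all add: core_def dilate_def)

lemma core_subgroup: "add_subgroup (core n)"
  using H_subgroup A_pow_minus[of n] A_pow_add[of n] A_pow_add[of n 0 0]
  by (simp add: add_subgroup_def core_vimage)

lemma core_open: "open (core n)"
  unfolding core_vimage using H_open A_pow_continuous(1) by (rule open_vimage)

lemma dilate_compact: "compact (dilate n)"
  unfolding dilate_def using A_pow_continuous(1) H_compact by (rule compact_continuous_image)

lemma dilate_open: "open (dilate n)"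
  unfolding dilate_vimage using H_open A_pow_continuous(2) by (rule open_vimage)

lemma A_pow_zero: "(A ^^ n) 0 = 0"
  using A_pow_add[of n 0 0] by simp

lemma dilate_subgroup: "add_subgroup (dilate n)"
  unfolding add_subgroup_def dilate_def
proof (intro conjI ballI)
  show "0 \<in> (A ^^ n) ` H"
    using A_pow_zero[of n] add_subgroupD(1)[OF H_subgroup] by (metis imageI)
  show "x + y \<in> (A ^^ n) ` H" if "x \<in> (A ^^ n) ` H" "y \<in> (A ^^ n) ` H" for x y
    using that add_subgroupD(2)[OF H_subgroup] by (auto simp flip: A_pow_add)
  show "- x \<in> (A ^^ n) ` H" if "x \<in> (A ^^ n) ` H" for x
    using that add_subgroupD(3)[OF H_subgroup] by (auto simp flip: A_pow_minus)
qed

lemma H_subset_A: "x \<in> H \<Longrightarrow> inv A x \<in> H"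
  using A_expansive by (force simp: expansive_def)

lemma core_Suc: "core (Suc n) \<subseteq> core n"
  unfolding core_def using H_subset_A by (auto simp: funpow_swap1)

lemma core_antimono: "m \<le> n \<Longrightarrow> core n \<subseteq> core m"
  using core_Suc by (rule lift_Suc_antimono_le)

lemma core_subset: "core n \<subseteq> H"
  using core_antimono[of 0 n] by simp

lemma dilate_Suc: "dilate n \<subseteq> dilate (Suc n)"
  unfolding dilate_vimage using H_subset_A by auto

lemma dilate_mono: "m \<le> n \<Longrightarrow> dilate m \<subseteq> dilate n"
  using dilate_Suc by (rule lift_Suc_mono_le)

lemma Inter_core: "(\<Inter>n. core n) = {0}"
proof -
  have "(\<Inter>n\<in>{n. n \<le> 0}. zpow A n ` H) = (\<Inter>n. core n)"
  proof (intro equalityI subsetI)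
    fix x assume x: "x \<in> (\<Inter>n\<in>{n. n \<le> 0}. zpow A n ` H)"
    have "x \<in> core n" for n
    proof -
      have "x \<in> zpow A (- int n) ` H" using INT_D[OF x, of "- int n"] by simp
      then show ?thesis by (cases "n = 0") (auto simp: zpow_def core_def)
    qed
    then show "x \<in> (\<Inter>n. core n)" by (rule INT_I)
  next
    fix x assume x: "x \<in> (\<Inter>n. core n)"
    have "x \<in> zpow A m ` H" if "m \<le> 0" for m
    proof -
      have "x \<in> core (nat (- m))" using x by (rule INT_D) simp
      then show ?thesis using that by (cases "m = 0") (auto simp: zpow_def core_def)
    qed
    then show "x \<in> (\<Inter>n\<in>{n. n \<le> 0}. zpow A n ` H)" by (intro INT_I) simp
  qed
  then show ?thesis using A_expansive by (simp add: expansive_def)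
qed

text \<open>The compact set \<^term>\<open>H - U\<close> is covered by the increasing open
  complements of these sets, so one of them already misses it.\<close>

lemma core_neighbourhood_base:
  assumes "open U" "0 \<in> U"
  shows "\<exists>n. core n \<subseteq> U"
proof -
  have closed: "closed (core n)" for n
  proof -
    have "compact (core n)"
      unfolding core_def using A_pow_continuous(2) H_compact by (rule compact_continuous_image)
    then show ?thesis by (rule compact_imp_closed)
  qed
  have "compact (H - U)"
    using H_compact assms(1) by (rule compact_diff)
  moreover have "open (- core n)" for n
    using closed by (rule open_Compl)
  moreover have "H - U \<subseteq> (\<Union>n\<in>UNIV. - core n)"
  proof
    fix x assume "x \<in> H - U"
    then have "x \<notin> (\<Inter>n. core n)" using Inter_core assms(2) by auto
    then show "x \<in> (\<Union>n. - core n)" by simp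
  qed
  ultimately obtain F where F: "finite F" "H - U \<subseteq> (\<Union>n\<in>F. - core n)"
    by (rule compactE_image)
  have "core (Max (insert 0 F)) \<subseteq> U"
  proof
    fix x assume x: "x \<in> core (Max (insert 0 F))"
    have "x \<in> core n" if "n \<in> insert 0 F" for n
      using subsetD[OF core_antimono[OF Max_ge[OF _ that]] x] F(1) by simp
    note mem = this
    have "x \<in> H" using mem[of 0] by simp
    moreover have "\<forall>n\<in>F. x \<in> core n" using mem by simp
    ultimately    show "x \<in> U" using F(2) by auto
  qed
  then show ?thesis by blast
qed

text \<open>The union is an open subgroup. If it were proper, some nontrivial character would be
  trivial on it, hence lie in the image of the annihilator of \<^term>\<open>H\<close> under
  every negative power of the adjoint, against the expansiveness of the adjoint.\<close>

lemma Union_dilate: "(\<Union>n. dilate n) = UNIV"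
proof (rule ccontr)
  let ?K = "\<Union>n. dilate n"
  assume "?K \<noteq> UNIV"
  then obtain x where "x \<notin> ?K" by blast
  have add: "x + y \<in> ?K" if xy: "x \<in> ?K" "y \<in> ?K" for x y
  proof -
    obtain m n where "x \<in> dilate m" "y \<in> dilate n" using xy by blast
    then have "x \<in> dilate (max m n)" "y \<in> dilate (max m n)"
      using dilate_mono[of m "max m n"] dilate_mono[of n "max m n"] by auto
    then show ?thesis using add_subgroupD(2)[OF dilate_subgroup] by blast
  qed
  have "0 \<in> ?K"
    using add_subgroupD(1)[OF dilate_subgroup[of 0]] by (rule UN_I[OF UNIV_I])
  moreover have "- x \<in> ?K" if "x \<in> ?K" for x
    using that by (auto dest: add_subgroupD(3)[OF dilate_subgroup])
  ultimately have "add_subgroup ?K"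
    unfolding add_subgroup_def using add by (intro conjI ballI)
  moreover have "open ?K" using dilate_open by (intro open_UN ballI)
  ultimately have "\<exists>\<xi>\<in>annihilator ?K. pairing x \<xi> \<noteq> 1"
    using \<open>x \<notin> ?K\<close> by (rule open_subgroup_separated_by_character)
  then obtain \<xi> where \<xi>: "\<xi> \<in> annihilator ?K" "pairing x \<xi> \<noteq> 1"
    by (elim bexE)
  let ?B = "adjoint_aut A"
  have B: "pairing x (?B \<gamma>) = pairing (A x) \<gamma>" for x \<gamma>
    using pairing_adjoint_aut[OF A_Aut] .
  have "inj ?B"
  proof (rule injI, rule pdual_eqI)
    fix \<gamma> \<delta> x assume "?B \<gamma> = ?B \<delta>"
    then have "pairing (A (inv A x)) \<gamma> = pairing (A (inv A x)) \<delta>" by (metis B)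
    then show "pairing x \<gamma> = pairing x \<delta>" by simp
  qed
  have Bn: "pairing x ((?B ^^ n) \<gamma>) = pairing ((A ^^ n) x) \<gamma>" for n x \<gamma>
    by (induction n arbitrary: x \<gamma>) (simp_all add: B funpow_swap1)
  have inv: "(inv ?B ^^ n) ((?B ^^ n) \<gamma>) = \<gamma>" for n \<gamma>
    by (induction n arbitrary: \<gamma>) (simp_all add: funpow_swap1 inv_f_f[OF \<open>inj ?B\<close>])
  have mem: "\<xi> \<in> (inv ?B ^^ n) ` annihilator H" for n
  proof
    show "\<xi> = (inv ?B ^^ n) ((?B ^^ n) \<xi>)" by (simp add: inv)
    show "(?B ^^ n) \<xi> \<in> annihilator H"
      using \<xi>(1) by (auto simp: annihilator_def Bn dilate_def)
  qed
  have "\<xi> \<in> zpow ?B m ` annihilator H" if "m \<le> 0" for m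
    using mem[of 0] mem[of "nat (- m)"] that by (cases "m = 0") (auto simp: zpow_def)
  then have "\<xi> \<in> (\<Inter>m\<in>{m. m \<le> 0}. zpow ?B m ` annihilator H)" by (intro INT_I) simp
  then have "\<xi> = 0"
    using A_adjoint_expansive unfolding expansive_def by simp
  then show False using \<xi>(2) by simp
qed

text \<open>The group is the union of the compact sets \<^term>\<open>dilate m\<close>, each of
  which is covered by finitely many cosets of the open subgroup \<^term>\<open>core n\<close>.\<close>

lemma core_coset_sequence: "\<exists>r. (\<Union>k::nat. coset (core n) (r k)) = UNIV"
proof -
  have "\<exists>R. finite R \<and> dilate m \<subseteq> (\<Union>a\<in>R. coset (core n) a)" for m
    by (rule compact_covered_by_finitely_many_cosets[OF dilate_compact core_subgroup core_open])
  then have "\<exists>R. \<forall>m. finite (R m) \<and> dilate m \<subseteq> (\<Union>a\<in>R m. coset (core n) a)"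
    by (intro choice allI)
  then obtain R where "\<forall>m. finite (R m) \<and> dilate m \<subseteq> (\<Union>a\<in>R m. coset (core n) a)"
    by (elim exE)
  then have R: "\<And>m. finite (R m)" "\<And>m. dilate m \<subseteq> (\<Union>a\<in>R m. coset (core n) a)"
    by simp_all
  let ?D = "\<Union>m. R m"
  have D: "countable ?D" using R(1) by (simp add: countable_finite)
  have cover: "\<exists>d\<in>?D. x \<in> coset (core n) d" for x
  proof -
    have "x \<in> (\<Union>m. dilate m)" using Union_dilate by simp
    then obtain m where "x \<in> dilate m" by (elim UN_E)
    with R(2)[of m] obtain d where "d \<in> R m" "x \<in> coset (core n) d" by auto
    then show ?thesis by auto
  qed
  from cover[of 0] have "?D \<noteq> {}" by auto
  have "\<exists>k. x \<in> coset (core n) (from_nat_into ?D k)" for x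
  proof -
    obtain d where d: "d \<in> ?D" "x \<in> coset (core n) d" using cover[of x] by (elim bexE)
    then have "d \<in> range (from_nat_into ?D)"
      using range_from_nat_into[OF \<open>?D \<noteq> {}\<close> D] by simp
    then show ?thesis using d(2) by auto
  qed
  then have "(\<Union>k. coset (core n) (from_nat_into ?D k)) = UNIV" by auto
  then show ?thesis by (rule exI[of _ "from_nat_into ?D"])
qed

definition rep :: "nat \<Rightarrow> nat \<Rightarrow> 'a" where
  "rep n = (SOME r. (\<Union>k::nat. coset (core n) (r k)) = UNIV)"

lemma rep: "(\<Union>k. coset (core n) (rep n k)) = UNIV"
  unfolding rep_def by (rule someI_ex[OF core_coset_sequence])

lemma open_eq_Union_cosets:
  assumes "open U"
  shows "U = (\<Union>(n, k)\<in>{(n, k). coset (core n) (rep n k) \<subseteq> U}. coset (core n) (rep n k))"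
proof (intro equalityI subsetI)
  fix x assume x: "x \<in> U"
  have "open ((\<lambda>y. y + x) -` U)"
    using assms by (intro open_vimage continuous_intros)
  then obtain n where n: "core n \<subseteq> (\<lambda>y. y + x) -` U"
    using core_neighbourhood_base[of "(\<lambda>y. y + x) -` U"] x by auto
  obtain k where k: "x \<in> coset (core n) (rep n k)"
    using rep by blast
  then have "coset (core n) (rep n k) = coset (core n) x"
    using coset_eq[OF core_subgroup] by (auto simp: coset_def)
  moreover have "y \<in> U" if "y \<in> coset (core n) x" for y
    using n that by (auto simp: coset_def)
  ultimately have "coset (core n) (rep n k) \<subseteq> U" by blast
  then show "x \<in> (\<Union>(n, k)\<in>{(n, k). coset (core n) (rep n k) \<subseteq> U}. coset (core n) (rep n k))"
    using k by blast
qed blast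

text \<open>Countably many cosets form a base of the topology. The empty set is listed because
  the intersection of two cosets may be empty, and the generator has to be closed under
  intersections.\<close>

lemma borel_eq_sigma_cosets: "sets borel = sigma_sets UNIV (insert {} {coset (core n) a | n a. True})"
proof
  let ?G = "insert {} {coset (core n) a | n a. True}"
  have "U \<in> sigma_sets UNIV ?G" if "open U" for U
  proof -
    have "(\<Union>p\<in>{(n, k). coset (core n) (rep n k) \<subseteq> U}. coset (core (fst p)) (rep (fst p) (snd p)))
        \<in> sigma_sets UNIV ?G"
      by (intro sigma_sets_UNION) (auto intro!: sigma_sets.Basic)
    then show ?thesis
      using open_eq_Union_cosets[OF that] by (simp add: case_prod_unfold)
  qed
  then show "sets borel \<subseteq> sigma_sets UNIV ?G"
    unfolding sets_borel by (intro sigma_sets_mono subsetI) simp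
  have "?G \<subseteq> sets borel"
    using open_coset[OF core_open] by auto
  then show "sigma_sets UNIV ?G \<subseteq> sets borel"
    using sets.sigma_sets_subset[of ?G borel] by simp
qed

lemma coset_borel [measurable]: "coset (core n) a \<in> sets borel" "coset H a \<in> sets borel"
  using open_coset[OF core_open] open_coset[OF H_open] by auto

text \<open>Continuity only gives measurability for the Borel sets of the product space. With
  respect to the product sigma-algebra one uses that the preimage of an open set is a countable
  union of products of cosets.\<close>

lemma measurable_group_add: "(\<lambda>(x, y). x + y) \<in> measurable (borel \<Otimes>\<^sub>M borel) (borel :: 'a measure)"
proof (rule borel_measurableI)
  fix U :: "'a set" assume U: "open U"
  let ?I = "{(n, j, k). coset (core n) (rep n j + rep n k) \<subseteq> U}"
  let ?R = "\<lambda>(n, j, k). coset (core n) (rep n j) \<times> coset (core n) (rep n k)"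
  have "(\<lambda>(x, y). x + y) -` U = (\<Union>i\<in>?I. ?R i)"
  proof (intro equalityI subsetI)
    fix p assume p: "p \<in> (\<Union>i\<in>?I. ?R i)"
    then obtain n j k where i: "coset (core n) (rep n j + rep n k) \<subseteq> U"
        "fst p - rep n j \<in> core n" "snd p - rep n k \<in> core n"
      by (auto simp: coset_def)
    have "fst p + snd p - (rep n j + rep n k) \<in> core n"
      using add_subgroupD(2)[OF core_subgroup i(2,3)] by (simp add: algebra_simps)
    then have "fst p + snd p \<in> U"
      using i(1) by (auto simp: coset_def)
    then show "p \<in> (\<lambda>(x, y). x + y) -` U"
      by (simp add: case_prod_unfold)
  next
    fix p assume p: "p \<in> (\<lambda>(x, y). x + y) -` U"
    obtain x y where xy: "p = (x, y)" by force
    have "open ((\<lambda>z. z + (x + y)) -` U)"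
      using U by (intro open_vimage continuous_intros)
    then obtain n where n: "core n \<subseteq> (\<lambda>z. z + (x + y)) -` U"
      using core_neighbourhood_base[of "(\<lambda>z. z + (x + y)) -` U"] p xy by auto
    obtain j k where jk: "x - rep n j \<in> core n" "y - rep n k \<in> core n"
      using rep[of n] unfolding coset_def by blast
    have "(x + y) - (rep n j + rep n k) \<in> core n"
      using add_subgroupD(2)[OF core_subgroup jk] by (simp add: algebra_simps)
    then have "coset (core n) (x + y) = coset (core n) (rep n j + rep n k)"
      by (rule coset_eq[OF core_subgroup])
    moreover have "coset (core n) (x + y) \<subseteq> U"
      using n by (auto simp: coset_def)
    ultimately have "(n, j, k) \<in> ?I" by simp
    then show "p \<in> (\<Union>i\<in>?I. ?R i)"
      using jk by (force simp: xy coset_def)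
  qed
  moreover have "(\<Union>i\<in>?I. ?R i) \<in> sets (borel \<Otimes>\<^sub>M borel)"
    by (intro sets.countable_UN') (auto intro!: pair_measureI coset_borel)
  ultimately show "(\<lambda>(x, y). x + y) -` U \<inter> space (borel \<Otimes>\<^sub>M borel) \<in> sets (borel \<Otimes>\<^sub>M borel)"
    by (simp add: space_pair_measure)
qed

end

section \<open>Square integrable functions and series\<close>

lemma L2_measurable: "f \<in> L2 M \<Longrightarrow> f \<in> borel_measurable M"
  by (simp add: L2_def)

lemma L2_integrable: "f \<in> L2 M \<Longrightarrow> integrable M (\<lambda>x. (cmod (f x))\<^sup>2)"
  by (simp add: L2_def)

lemma borel_measurable_cnj [measurable (raw)]:
  "f \<in> borel_measurable M \<Longrightarrow> (\<lambda>x. cnj (f x)) \<in> borel_measurable M"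
  using measurable_compose[of f M borel cnj borel] borel_measurable_continuous_onI[of cnj]
    continuous_on_cnj[OF continuous_on_id] by simp

lemma L2_mult_integrable:
  assumes f: "f \<in> L2 M" and g: "g \<in> L2 M"
  shows "integrable M (\<lambda>x. f x * cnj (g x))"
proof (rule Bochner_Integration.integrable_bound)
  show "integrable M (\<lambda>x. (cmod (f x))\<^sup>2 + (cmod (g x))\<^sup>2)"
    using L2_integrable[OF f] L2_integrable[OF g] by (rule Bochner_Integration.integrable_add)
  show "(\<lambda>x. f x * cnj (g x)) \<in> borel_measurable M"
    using L2_measurable[OF f] L2_measurable[OF g] by measurable
  have "cmod (f x) * cmod (g x) \<le> (cmod (f x))\<^sup>2 + (cmod (g x))\<^sup>2" for x
    using sum_squares_bound[of "cmod (f x)" "cmod (g x)"]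
      mult_nonneg_nonneg[OF norm_ge_zero norm_ge_zero, of "f x" "g x"] unfolding mult.assoc by linarith
  then show "AE x in M. norm (f x * cnj (g x)) \<le> norm ((cmod (f x))\<^sup>2 + (cmod (g x))\<^sup>2)"
    by (simp add: norm_mult)
qed

lemma L2_inner_cnj:
  "L2_inner M g f = cnj (L2_inner M f g)"
proof -
  have "cnj (L2_inner M f g) = (\<integral>x. cnj (f x * cnj (g x)) \<partial>M)"
    unfolding L2_inner_def by (rule Bochner_Integration.integral_cnj[symmetric])
  also have "\<dots> = L2_inner M g f"
    unfolding L2_inner_def by (simp only: complex_cnj_mult complex_cnj_cnj mult.commute)
  finally show ?thesis by (rule sym)
qed

text \<open>Expand the square of the distance from \<^term>\<open>f\<close> to its orthogonal
  projection, which is nonnegative.\<close>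

lemma bessel_inequality:
  assumes F: "finite F" and u: "\<And>i. i \<in> F \<Longrightarrow> u i \<in> L2 M" and f: "f \<in> L2 M"
    and orth: "\<And>i j. i \<in> F \<Longrightarrow> j \<in> F \<Longrightarrow> L2_inner M (u i) (u j) = (if i = j then 1 else 0)"
  shows "(\<Sum>i\<in>F. (cmod (L2_inner M f (u i)))\<^sup>2) \<le> (\<integral>x. (cmod (f x))\<^sup>2 \<partial>M)"
proof -
  define c where "c i = L2_inner M f (u i)" for i
  have pointwise: "complex_of_real ((cmod (f x - (\<Sum>i\<in>F. c i * u i x)))\<^sup>2) =
      f x * cnj (f x) - (\<Sum>i\<in>F. cnj (c i) * (f x * cnj (u i x)))
      - (\<Sum>i\<in>F. c i * (u i x * cnj (f x)))
      + (\<Sum>i\<in>F. \<Sum>j\<in>F. (c i * cnj (c j)) * (u i x * cnj (u j x)))" for x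
  proof -
    let ?p = "\<Sum>i\<in>F. c i * u i x"
    have "complex_of_real ((cmod (f x - ?p))\<^sup>2) = f x * cnj (f x) - f x * cnj ?p - ?p * cnj (f x) + ?p * cnj ?p"
      unfolding complex_norm_square by (simp add: algebra_simps)
    also have "f x * cnj ?p = (\<Sum>i\<in>F. cnj (c i) * (f x * cnj (u i x)))"
      by (simp add: sum_distrib_left mult_ac)
    also have "?p * cnj (f x) = (\<Sum>i\<in>F. c i * (u i x * cnj (f x)))"
      unfolding sum_distrib_right by (simp add: mult_ac)
    also have "?p * cnj ?p = (\<Sum>i\<in>F. \<Sum>j\<in>F. (c i * cnj (c j)) * (u i x * cnj (u j x)))"
      unfolding cnj_sum sum_product by (simp add: mult_ac)
    finally show ?thesis .
  qed
  have fu: "integrable M (\<lambda>x. f x * cnj (u i x))" "integrable M (\<lambda>x. u i x * cnj (f x))"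
    if "i \<in> F" for i using L2_mult_integrable f u[OF that] by blast+
  have uu: "integrable M (\<lambda>x. u i x * cnj (u j x))" if "i \<in> F" "j \<in> F" for i j
    using L2_mult_integrable u that by blast
  have ff: "integrable M (\<lambda>x. f x * cnj (f x))" using L2_mult_integrable f by blast
  have "complex_of_real (\<integral>x. (cmod (f x - (\<Sum>i\<in>F. c i * u i x)))\<^sup>2 \<partial>M) =
      (\<integral>x. f x * cnj (f x) - (\<Sum>i\<in>F. cnj (c i) * (f x * cnj (u i x)))
      - (\<Sum>i\<in>F. c i * (u i x * cnj (f x)))
      + (\<Sum>i\<in>F. \<Sum>j\<in>F. (c i * cnj (c j)) * (u i x * cnj (u j x))) \<partial>M)"
    unfolding integral_complex_of_real[symmetric] pointwise ..
  also have "\<dots> = L2_inner M f f - (\<Sum>i\<in>F. cnj (c i) * c i)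
      - (\<Sum>i\<in>F. c i * L2_inner M (u i) f)
      + (\<Sum>i\<in>F. \<Sum>j\<in>F. (c i * cnj (c j)) * L2_inner M (u i) (u j))"
    using fu uu ff
    by (simp add: Bochner_Integration.integral_add Bochner_Integration.integral_diff
        Bochner_Integration.integral_sum L2_inner_def c_def)
  also have "(\<Sum>i\<in>F. \<Sum>j\<in>F. (c i * cnj (c j)) * L2_inner M (u i) (u j)) =
      (\<Sum>i\<in>F. \<Sum>j\<in>F. if i = j then c i * cnj (c j) else 0)"
    by (intro sum.cong refl) (simp add: orth)
  also have "\<dots> = (\<Sum>i\<in>F. c i * cnj (c i))"
    using F by simp
  also have "(\<Sum>i\<in>F. c i * L2_inner M (u i) f) = (\<Sum>i\<in>F. c i * cnj (c i))"
    by (simp add: c_def L2_inner_cnj[of M _ f])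
  also have "(\<Sum>i\<in>F. c i * cnj (c i)) = complex_of_real (\<Sum>i\<in>F. (cmod (c i))\<^sup>2)"
    unfolding of_real_sum complex_norm_square ..
  also have "(\<Sum>i\<in>F. cnj (c i) * c i) = complex_of_real (\<Sum>i\<in>F. (cmod (c i))\<^sup>2)"
    unfolding of_real_sum complex_norm_square by (simp only: mult.commute)
  also have "L2_inner M f f = complex_of_real (\<integral>x. (cmod (f x))\<^sup>2 \<partial>M)"
    unfolding L2_inner_def integral_complex_of_real[symmetric] complex_norm_square ..
  finally have "complex_of_real (\<integral>x. (cmod (f x - (\<Sum>i\<in>F. c i * u i x)))\<^sup>2 \<partial>M) =
      complex_of_real ((\<integral>x. (cmod (f x))\<^sup>2 \<partial>M) - (\<Sum>i\<in>F. (cmod (c i))\<^sup>2))"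
    by simp
  then have "(\<integral>x. (cmod (f x - (\<Sum>i\<in>F. c i * u i x)))\<^sup>2 \<partial>M) =
      (\<integral>x. (cmod (f x))\<^sup>2 \<partial>M) - (\<Sum>i\<in>F. (cmod (c i))\<^sup>2)"
    unfolding of_real_eq_iff .
  moreover have "0 \<le> (\<integral>x. (cmod (f x - (\<Sum>i\<in>F. c i * u i x)))\<^sup>2 \<partial>M)"
    by (rule integral_nonneg_AE) simp
  ultimately show ?thesis by (simp add: c_def)
qed

text \<open>Termwise integration of a series with absolutely summable weights. The bound
  \<^term>\<open>w\<close> makes the series converge at every point, and
  \<^term>\<open>B\<close> makes the integrals of the absolute values summable.\<close>

lemma
  fixes c :: "nat \<Rightarrow> complex" and k :: "nat \<Rightarrow> 'b \<Rightarrow> complex"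
  assumes c: "summable (\<lambda>n. cmod (c n))" and k: "\<And>n. integrable M (k n)"
    and w: "\<And>n y. cmod (k n y) \<le> w y" and B: "\<And>n. (\<integral>y. cmod (k n y) \<partial>M) \<le> B"
  shows integrable_weighted_series: "integrable M (\<lambda>y. \<Sum>n. c n * k n y)"
    and sums_weighted_series: "(\<lambda>n. c n * (\<integral>y. k n y \<partial>M)) sums (\<integral>y. (\<Sum>n. c n * k n y) \<partial>M)"
proof -
  have 1: "integrable M (\<lambda>y. c n * k n y)" for n
    using k by (rule integrable_mult_right)
  have 2: "summable (\<lambda>n. cmod (c n * k n y))" for y
  proof (rule summable_comparison_test'[OF summable_mult2[OF c, of "w y"], of 0])
    show "norm (cmod (c n * k n y)) \<le> cmod (c n) * w y" for n
      using mult_left_mono[OF w norm_ge_zero] by (simp add: norm_mult)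
  qed
  have 3: "summable (\<lambda>n. \<integral>y. cmod (c n * k n y) \<partial>M)"
  proof (rule summable_comparison_test'[OF summable_mult2[OF c, of B], of 0])
    show "norm (\<integral>y. cmod (c n * k n y) \<partial>M) \<le> cmod (c n) * B" for n
      using mult_left_mono[OF B norm_ge_zero] by (simp add: norm_mult abs_mult)
  qed
  show "integrable M (\<lambda>y. \<Sum>n. c n * k n y)"
    by (rule integrable_suminf[OF 1 AE_I2[OF 2] 3])
  show "(\<lambda>n. c n * (\<integral>y. k n y \<partial>M)) sums (\<integral>y. (\<Sum>n. c n * k n y) \<partial>M)"
    using sums_integral[OF 1 AE_I2[OF 2] 3] by simp
qed

section \<open>Haar measure\<close>

lemma haar_sets [measurable_cong]: "haar_measure M \<Longrightarrow> sets M = sets borel"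
  by (simp add: haar_measure_def)

lemma haar_space: "haar_measure M \<Longrightarrow> space M = UNIV"
  using sets_eq_imp_space_eq[OF haar_sets] by simp

lemma haar_borel_measurable: "haar_measure M \<Longrightarrow> borel_measurable M = borel_measurable borel"
  by (rule measurable_cong_sets) (simp_all add: haar_sets)

lemma measurable_translation: "(\<lambda>x. a + x) \<in> measurable borel (borel :: 'a::topological_ab_group_add measure)"
  by (intro borel_measurable_continuous_onI continuous_intros)

lemma haar_measurable_translation:
  assumes "haar_measure M" shows "(\<lambda>x. a + x) \<in> measurable M M"
  using measurable_translation[of a]
  unfolding measurable_cong_sets[OF haar_sets[OF assms] haar_sets[OF assms]] .

lemma haar_emeasure_image:
  "haar_measure M \<Longrightarrow> B \<in> sets borel \<Longrightarrow> emeasure M ((+) x ` B) = emeasure M B"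
  unfolding haar_measure_def by blast

lemma haar_emeasure_coset:
  assumes "haar_measure M" "S \<in> sets borel"
  shows "emeasure M (coset S a) = emeasure M S"
  unfolding image_add_eq_coset[symmetric] using assms by (rule haar_emeasure_image)

lemma haar_distr_translation:
  assumes M: "haar_measure M"
  shows "distr M M (\<lambda>x. a + x) = M"
proof (rule measure_eqI)
  fix B assume "B \<in> sets (distr M M (\<lambda>x. a + x))"
  then have B: "B \<in> sets borel" using haar_sets[OF M] by simp
  have vim: "(\<lambda>x. a + x) -` B = (+) (- a) ` B"
    by (force simp: image_iff intro: bexI[of _ "a + _"])
  have "emeasure (distr M M (\<lambda>x. a + x)) B = emeasure M ((\<lambda>x. a + x) -` B)"
    using B haar_space[OF M]
    by (simp add: emeasure_distr[OF haar_measurable_translation[OF M]] haar_sets[OF M])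
  also have "\<dots> = emeasure M B"
    unfolding vim using M B by (rule haar_emeasure_image)
  finally show "emeasure (distr M M (\<lambda>x. a + x)) B = emeasure M B" .
qed simp

lemma haar_integral_translation:
  fixes f :: "_ \<Rightarrow> _::{banach, second_countable_topology}"
  assumes M: "haar_measure M" and f: "f \<in> borel_measurable M"
  shows "(\<integral>x. f (a + x) \<partial>M) = (\<integral>x. f x \<partial>M)"
  using integral_distr[OF haar_measurable_translation[OF M] f] by (simp add: haar_distr_translation[OF M])

lemma haar_integrable_translation:
  fixes f :: "_ \<Rightarrow> _::{banach, second_countable_topology}"
  assumes M: "haar_measure M" and f: "integrable M f"
  shows "integrable M (\<lambda>x. f (a + x))"
  using integrable_distr[OF haar_measurable_translation[OF M], of a f] f
  by (simp add: haar_distr_translation[OF M])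

lemma haar_AE_translation:
  assumes M: "haar_measure M" and "AE x in M. P x"
  shows "AE x in M. P (a + x)"
proof -
  have "AE x in distr M M (\<lambda>x. a + x). P x"
    unfolding haar_distr_translation[OF M] by (rule assms(2))
  then show ?thesis by (rule AE_distrD[OF haar_measurable_translation[OF M]])
qed

lemma haar_sigma_finite:
  assumes M: "haar_measure M" and S: "S \<in> sets borel" "emeasure M S = 1"
    and r: "(\<Union>k::nat. coset S (r k)) = UNIV" and c: "\<And>k. coset S (r k) \<in> sets borel"
  shows "sigma_finite_measure M"
proof
  show "\<exists>C. countable C \<and> C \<subseteq> sets M \<and> \<Union> C = space M \<and> (\<forall>a\<in>C. emeasure M a \<noteq> \<infinity>)"
    using r c haar_space[OF M] haar_sets[OF M] haar_emeasure_coset[OF M S(1)] S(2)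
    by (intro exI[of _ "range (\<lambda>k. coset S (r k))"]) auto
qed

text \<open>Translation by an element \<^term>\<open>s\<close> of \<^term>\<open>S\<close>
  preserves the integral and multiplies it by \<^term>\<open>\<theta> s\<close>, so the integral
  vanishes unless \<^term>\<open>\<theta>\<close> is trivial on \<^term>\<open>S\<close>.\<close>

lemma haar_integral_character:
  fixes \<theta> :: "'a::topological_ab_group_add \<Rightarrow> complex"
  assumes M: "haar_measure M" and S: "add_subgroup S" "open S" "emeasure M S = 1"
    and \<theta>: "continuous_on UNIV \<theta>" "\<And>x y. \<theta> (x + y) = \<theta> x * \<theta> y"
  shows "(\<integral>x. indicator (coset S b) x * \<theta> x \<partial>M) = (if \<forall>s\<in>S. \<theta> s = 1 then \<theta> b else 0)"
proof (cases "\<forall>s\<in>S. \<theta> s = 1")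
  case True
  have "\<theta> x = \<theta> b" if "x \<in> coset S b" for x
  proof -
    have "\<theta> (b + (x - b)) = \<theta> b * \<theta> (x - b)" by (rule \<theta>)
    then show ?thesis using that True by (simp add: coset_def)
  qed
  then have "(\<integral>x. indicator (coset S b) x * \<theta> x \<partial>M) = (\<integral>x. indicator (coset S b) x * \<theta> b \<partial>M)"
    by (intro Bochner_Integration.integral_cong) (auto simp: indicator_def)
  also have "\<dots> = (\<integral>x. indicator (coset S b) x *\<^sub>R \<theta> b \<partial>M)"
    by (intro Bochner_Integration.integral_cong) (auto simp: indicator_def)
  also have "\<dots> = measure M (coset S b) *\<^sub>R \<theta> b"
    using haar_emeasure_coset[OF M, of S b] open_coset[OF S(2), of b] S haar_sets[OF M]
    by (simp add: haar_space[OF M])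
  also have "measure M (coset S b) = 1"
    using haar_emeasure_coset[OF M, of S b] S by (simp add: measure_def)
  finally show ?thesis using True by simp
next
  case False
  then obtain s where s: "s \<in> S" "\<theta> s \<noteq> 1" by blast
  let ?f = "\<lambda>x. indicator (coset S b) x * \<theta> x"
  have "?f \<in> borel_measurable borel"
    using borel_measurable_continuous_onI[OF \<theta>(1)] open_coset[OF S(2), of b]
    by (intro borel_measurable_times borel_measurable_indicator) auto
  then have "?f \<in> borel_measurable M" by (simp add: haar_borel_measurable[OF M])
  then have "(\<integral>x. ?f x \<partial>M) = (\<integral>x. ?f (s + x) \<partial>M)"
    by (rule haar_integral_translation[OF M, symmetric])
  also have "\<dots> = (\<integral>x. \<theta> s * ?f x \<partial>M)"
  proof (intro Bochner_Integration.integral_cong refl)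
    fix x
    have "s + x - b \<in> S \<longleftrightarrow> x - b \<in> S"
      using add_subgroupD(2)[OF S(1) s(1), of "x - b"] add_subgroup_diff[OF S(1) _ s(1), of "s + x - b"]
      by (auto simp: algebra_simps)
    then show "?f (s + x) = \<theta> s * ?f x"
      by (simp add: coset_def indicator_def \<theta>(2))
  qed
  also have "\<dots> = \<theta> s * (\<integral>x. ?f x \<partial>M)"
    by (rule integral_mult_right_zero)
  finally have "(\<integral>x. ?f x \<partial>M) = 0" using s by simp
  then show ?thesis by (simp only: False if_False)
qed

section \<open>The dual group\<close>

lemma pairing_zero_left [simp]: "pairing 0 \<xi> = 1"
proof -
  have "pairing 0 \<xi> = pairing 0 \<xi> * pairing 0 \<xi>"
    using pairing_add_left[of 0 0 \<xi>] by simp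
  moreover have "pairing 0 \<xi> \<noteq> 0" using norm_pairing[of 0 \<xi>] by fastforce
  ultimately show ?thesis by simp
qed

lemma pairing_cnj: "cnj (pairing x \<xi>) * pairing x \<xi> = 1"
  by (rule unimodular_cnj) simp

lemma pairing_minus_left: "pairing (- x) \<xi> = cnj (pairing x \<xi>)"
proof -
  have "pairing (- x) \<xi> * pairing x \<xi> = 1"
    using pairing_add_left[of "- x" x \<xi>] by simp
  then show ?thesis
    using pairing_cnj[of x \<xi>] by (metis mult.assoc mult.commute mult_1)
qed

lemma pairing_diff_left: "pairing (x - y) \<xi> = pairing x \<xi> * cnj (pairing y \<xi>)"
  using pairing_add_left[of x "- y" \<xi>] by (simp add: pairing_minus_left)

lemma pairing_diff_right: "pairing x (\<xi> - \<eta>) = pairing x \<xi> * cnj (pairing x \<eta>)"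
  using pairing_add_right[of x \<xi> "- \<eta>"] by (simp add: pairing_uminus_right)

lemma continuous_on_pairing_right: "continuous_on S (\<lambda>\<xi>. pairing x \<xi>)"
proof -
  have "isCont (pairing x) \<xi>" for \<xi>
    unfolding isCont_def
  proof (rule tendstoI)
    fix e :: real assume "e > 0"
    then have "eventually (\<lambda>\<eta>. \<eta> \<in> pdual_nbhd \<xi> {x} e) (nhds \<xi>)"
      by (auto intro!: eventually_nhds_in_open open_pdual_nbhd centre_in_pdual_nbhd)
    then have "eventually (\<lambda>\<eta>. dist (pairing x \<eta>) (pairing x \<xi>) < e) (nhds \<xi>)"
      by (rule eventually_mono) (simp add: pdual_nbhd_def dist_norm)
    then show "eventually (\<lambda>\<eta>. dist (pairing x \<eta>) (pairing x \<xi>) < e) (at \<xi>)"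
      unfolding at_within_def by (rule filter_leD[OF inf_le1])
  qed
  then show ?thesis by (intro continuous_at_imp_continuous_on) auto
qed

lemma add_subgroup_annihilator: "add_subgroup (annihilator S)"
  by (auto simp: add_subgroup_def annihilator_def pairing_add_right pairing_uminus_right)

text \<open>As long as the powers stay near 1, squaring stretches the distance to 1 by a factor
  of at least 3/2, so that distance must be zero: the circle has no small subgroups.\<close>

lemma unimodular_powers_near_one:
  fixes z :: complex
  assumes "\<And>k. cmod (z ^ k - 1) < 1 / 2"
  shows "z = 1"
proof (rule ccontr)
  assume "z \<noteq> 1"
  have grow: "(3 / 2) ^ k * cmod (z - 1) \<le> cmod (z ^ (2 ^ k) - 1)" for k
  proof (induction k)
    case (Suc k)
    let ?w = "z ^ (2 ^ k)"
    have "3 / 2 \<le> cmod (?w + 1)"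
      using norm_triangle_ineq2[of 2 "1 - ?w"] assms[of "2 ^ k"]
      by (simp add: norm_minus_commute add.commute)
    then have "3 / 2 * ((3 / 2) ^ k * cmod (z - 1)) \<le> cmod (?w + 1) * cmod (?w - 1)"
      using Suc.IH by (intro mult_mono) auto
    also have "\<dots> = cmod (z ^ (2 ^ Suc k) - 1)"
      by (simp flip: norm_mult add: algebra_simps power_add mult_2)
    finally show ?case by simp
  qed simp
  obtain k where "1 / cmod (z - 1) < (3 / 2) ^ k"
    using real_arch_pow[of "3 / 2"] by force
  then have "1 < (3 / 2) ^ k * cmod (z - 1)"
    using \<open>z \<noteq> 1\<close> by (simp add: field_simps)
  then show False using grow[of k] assms[of "2 ^ k"] by simp
qed

lemma pairing_nsmul: "pairing (nsmul n x) \<xi> = pairing x \<xi> ^ n"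
  by (induction n) (simp_all add: pairing_add_left)

lemma annihilatorI_near_one:
  assumes "add_subgroup S" "\<And>x. x \<in> S \<Longrightarrow> cmod (pairing x \<xi> - 1) < 1 / 2"
  shows "\<xi> \<in> annihilator S"
  unfolding annihilator_def
proof (intro CollectI ballI)
  fix x assume x: "x \<in> S"
  have "nsmul n x \<in> S" for n
    by (induction n) (use x add_subgroupD[OF assms(1)] in auto)
  then have "cmod (pairing x \<xi> ^ n - 1) < 1 / 2" for n
    using assms(2)[of "nsmul n x"] by (simp add: pairing_nsmul)
  then show "pairing x \<xi> = 1"
    by (rule unimodular_powers_near_one)
qed

text \<open>Since the circle has no small subgroups, being close to the trivial character on
  \<^term>\<open>S\<close> is the same as being trivial there.\<close>

lemma open_annihilator:
  assumes "add_subgroup S" "compact S"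
  shows "open (annihilator S)"
proof -
  have "annihilator S = pdual_nbhd 0 S (1 / 2)"
  proof (intro equalityI subsetI)
    fix \<xi> assume "\<xi> \<in> annihilator S"
    then show "\<xi> \<in> pdual_nbhd 0 S (1 / 2)"
      by (simp add: pdual_nbhd_def annihilator_def)
  next
    fix \<xi> assume "\<xi> \<in> pdual_nbhd 0 S (1 / 2)"
    then show "\<xi> \<in> annihilator S"
      by (intro annihilatorI_near_one[OF assms(1)]) (simp add: pdual_nbhd_def)
  qed
  then show ?thesis using open_pdual_nbhd[OF assms(2)] by simp
qed

section \<open>The orthonormal basis of time-frequency shifts of a coset indicator\<close>

locale expansive_haar = expansive_group A H
  for A :: "'a::{topological_ab_group_add, t2_space} \<Rightarrow> 'a" and H :: "'a set" +
  fixes mG :: "'a measure" and mD :: "'a pdual measure"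
  assumes mG: "haar_measure mG" and mG_H: "emeasure mG H = 1"
    and mD: "haar_measure mD" and mD_H: "emeasure mD (annihilator H) = 1"
begin

lemma mG_sets [measurable_cong]: "sets mG = sets borel"
  by (rule haar_sets[OF mG])

lemma mD_sets [measurable_cong]: "sets mD = sets borel"
  by (rule haar_sets[OF mD])

lemma mG_space [simp]: "space mG = UNIV" and mD_space [simp]: "space mD = UNIV"
  by (rule haar_space[OF mG], rule haar_space[OF mD])

lemma emeasure_coset: "emeasure mG (coset H a) = 1"
  using haar_emeasure_coset[OF mG, of H] mG_H H_open by simp

lemma emeasure_dual_coset: "emeasure mD (coset (annihilator H) \<beta>) = 1"
  using haar_emeasure_coset[OF mD, of "annihilator H"] mD_H open_annihilator[OF H_subgroup H_compact]
  by simp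

lemma annihilator_coset_borel [measurable]: "coset (annihilator H) \<beta> \<in> sets borel"
  using open_coset[OF open_annihilator[OF H_subgroup H_compact]] by simp

lemma pairing_measurable [measurable]:
  "(\<lambda>y. pairing y \<xi>) \<in> borel_measurable borel" "(\<lambda>\<xi>. pairing y \<xi>) \<in> borel_measurable borel"
  by (intro borel_measurable_continuous_onI continuous_on_pairing continuous_on_pairing_right)+

lemma integral_pairing:
  "(\<integral>y. indicator (coset H b) y * pairing y \<xi> \<partial>mG) = (if \<xi> \<in> annihilator H then pairing b \<xi> else 0)"
  using haar_integral_character[OF mG H_subgroup H_open mG_H continuous_on_pairing pairing_add_left]
  by (simp add: annihilator_def)

lemma double_annihilator: "(\<forall>\<xi>\<in>annihilator H. pairing y \<xi> = 1) \<longleftrightarrow> y \<in> H"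
proof
  show "y \<in> H" if "\<forall>\<xi>\<in>annihilator H. pairing y \<xi> = 1"
    using that open_subgroup_separated_by_character[OF H_subgroup H_open, of y] by auto
qed (simp add: annihilator_def)

lemma integral_pairing_dual:
  "(\<integral>\<xi>. indicator (coset (annihilator H) \<beta>) \<xi> * pairing y \<xi> \<partial>mD) = (if y \<in> H then pairing y \<beta> else 0)"
  using haar_integral_character[OF mD add_subgroup_annihilator open_annihilator[OF H_subgroup H_compact]
      mD_H continuous_on_pairing_right pairing_add_right, of \<beta> y]
  by (simp add: double_annihilator)

text \<open>The time-frequency shift by \<^term>\<open>z\<close> of the indicator of
  \<^term>\<open>H\<close>.\<close>

definition atom :: "'a \<times> 'a pdual \<Rightarrow> 'a \<Rightarrow> complex" where
  "atom z y = pairing y (snd z) * indicator (coset H (fst z)) y"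

text \<open>Shifts by elements of this subgroup fix the indicator of \<^term>\<open>H\<close>,
  so its cosets are the natural index set of the atoms.\<close>

definition cell :: "('a \<times> 'a pdual) set" where
  "cell = H \<times> annihilator H"

lemma add_subgroup_cell: "add_subgroup cell"
  using H_subgroup add_subgroup_annihilator[of H]
  by (auto simp: cell_def add_subgroup_def zero_prod_def)

lemma atom_measurable [measurable]: "atom z \<in> borel_measurable borel"
  unfolding atom_def by measurable

lemma atom_measurable' [measurable]: "atom z \<in> borel_measurable mG"
  by (simp add: haar_borel_measurable[OF mG])

lemma norm_atom: "cmod (atom z y) = indicator (coset H (fst z)) y"
  by (simp add: atom_def norm_mult indicator_def)

lemma integrable_indicator_coset: "integrable mG (indicator (coset H a) :: 'a \<Rightarrow> real)"
  using emeasure_coset[of a] by (intro integrable_real_indicator) (simp_all add: mG_sets)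

lemma atom_L2: "atom z \<in> L2 mG"
proof -
  have "(\<lambda>x. (cmod (atom z x))\<^sup>2) = indicator (coset H (fst z))"
    by (auto simp: norm_atom indicator_def)
  then show ?thesis
    using integrable_indicator_coset by (simp add: L2_def)
qed

text \<open>Different cosets of \<^term>\<open>H\<close> give disjoint supports, and on a single
  coset the integrand is a character, whose integral vanishes unless it is trivial on
  \<^term>\<open>H\<close>.\<close>

lemma atom_inner:
  "L2_inner mG (atom z) (atom w) =
     (if z - w \<in> cell then pairing (fst z) (snd z - snd w) else 0)"
proof (cases "fst z - fst w \<in> H")
  case True
  have "atom z y * cnj (atom w y) = indicator (coset H (fst z)) y * pairing y (snd z - snd w)" for y
    using coset_eq[OF H_subgroup True]
    by (simp add: atom_def pairing_diff_right indicator_def)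
  then show ?thesis
    using True by (simp add: L2_inner_def integral_pairing cell_def mem_Times_iff)
next
  case False
  have "y \<notin> coset H (fst z) \<or> y \<notin> coset H (fst w)" for y
    using add_subgroup_diff[OF H_subgroup, of "y - fst w" "y - fst z"] False by (auto simp: coset_def)
  then have "(\<lambda>y. atom z y * cnj (atom w y)) = (\<lambda>_. 0)"
    by (auto simp: atom_def indicator_def fun_eq_iff)
  then have "L2_inner mG (atom z) (atom w) = 0"
    by (simp only: L2_inner_def integral_zero)
  then show ?thesis
    using False by (simp add: cell_def mem_Times_iff)
qed

text \<open>On a coset of \<^term>\<open>H\<close> a character from the annihilator is constant;
  moving \<^term>\<open>z\<close> inside its coset therefore only changes a phase, and all
  absolute values below depend on the coset alone.\<close>

lemma atom_cong:
  assumes "z - w \<in> cell"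
  shows "atom z y = pairing (fst z) (snd z - snd w) * atom w y"
proof -
  have H: "fst z - fst w \<in> H" and X: "snd z - snd w \<in> annihilator H"
    using assms by (simp_all add: cell_def mem_Times_iff)
  have "pairing y (snd z) = pairing (fst z) (snd z - snd w) * pairing y (snd w)"
    if y: "y \<in> coset H (fst z)"
  proof -
    have "pairing (y - fst z) (snd z - snd w) = 1"
      using X y by (simp add: annihilator_def coset_def)
    moreover have "pairing (fst z + (y - fst z)) (snd z - snd w)
        = pairing (fst z) (snd z - snd w) * pairing (y - fst z) (snd z - snd w)"
      by (rule pairing_add_left)
    ultimately have *: "pairing y (snd z - snd w) = pairing (fst z) (snd z - snd w)"
      by simp
    have "pairing y (snd w + (snd z - snd w)) = pairing y (snd w) * pairing y (snd z - snd w)"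
      by (rule pairing_add_right)
    then show ?thesis unfolding * by simp
  qed
  then show ?thesis
    using coset_eq[OF H_subgroup H] by (simp add: atom_def indicator_def)
qed

lemma inner_atom_phase:
  assumes "z - w \<in> cell"
  shows "L2_inner mG f (atom z) = cnj (pairing (fst z) (snd z - snd w)) * L2_inner mG f (atom w)"
proof -
  have "L2_inner mG f (atom z) = (\<integral>y. cnj (pairing (fst z) (snd z - snd w)) * (f y * cnj (atom w y)) \<partial>mG)"
    unfolding L2_inner_def atom_cong[OF assms]
    by (intro Bochner_Integration.integral_cong) (simp_all add: mult_ac)
  also have "\<dots> = cnj (pairing (fst z) (snd z - snd w)) * L2_inner mG f (atom w)"
    unfolding L2_inner_def by (rule integral_mult_right_zero)
  finally show ?thesis .
qed

lemma inner_atom_cong: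
  assumes "z - w \<in> cell"
  shows "cmod (L2_inner mG f (atom z)) = cmod (L2_inner mG f (atom w))"
  using inner_atom_phase[OF assms] by (simp add: norm_mult)

lemma atoms_bessel:
  assumes F: "finite F" and f: "f \<in> L2 mG"
    and sep: "\<And>i j. i \<in> F \<Longrightarrow> j \<in> F \<Longrightarrow> t i - t j \<in> cell \<Longrightarrow> i = j"
  shows "(\<Sum>i\<in>F. (cmod (L2_inner mG f (atom (t i))))\<^sup>2) \<le> (\<integral>x. (cmod (f x))\<^sup>2 \<partial>mG)"
proof (rule bessel_inequality[OF F atom_L2 f])
  fix i j assume ij: "i \<in> F" "j \<in> F"
  show "L2_inner mG (atom (t i)) (atom (t j)) = (if i = j then 1 else 0)"
    using sep[OF ij] add_subgroupD(1)[OF add_subgroup_cell] by (auto simp: atom_inner)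
qed

text \<open>The characters of the quotient of \<^term>\<open>H\<close> by \<^term>\<open>core
  n\<close>, extended by zero. They are collected as functions, since different elements of the
  dual may agree on \<^term>\<open>H\<close>.\<close>

definition level_characters :: "nat \<Rightarrow> ('a \<Rightarrow> complex) set" where
  "level_characters n = (\<lambda>\<xi>. atom (0, \<xi>)) ` annihilator (core n)"

lemma core_borel [measurable]: "core n \<in> sets borel"
  using core_open by simp

lemma emeasure_core: "emeasure mG (core n) \<noteq> 0" "emeasure mG (core n) \<noteq> \<infinity>"
proof -
  obtain R where R: "finite R" "H \<subseteq> (\<Union>r\<in>R. coset (core n) r)"
    using compact_covered_by_finitely_many_cosets[OF H_compact core_subgroup[of n] core_open]
    by (elim exE conjE)
  show "emeasure mG (core n) \<noteq> 0"
  proof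
    assume "emeasure mG (core n) = 0"
    then have "emeasure mG (coset (core n) r) = 0" for r
      using haar_emeasure_coset[OF mG core_borel] by simp
    then have "(\<Union>r\<in>R. coset (core n) r) \<in> null_sets mG"
      using R(1) by (intro null_sets.finite_UN null_setsI) (simp_all add: mG_sets)
    moreover have "H \<in> sets mG" using H_open by (simp add: mG_sets)
    ultimately have "emeasure mG H = 0"
      using R(2) null_sets_subset by (metis null_setsD1)
    then show False using mG_H by simp
  qed
  have "emeasure mG (core n) \<le> emeasure mG H"
    using H_open by (intro emeasure_mono core_subset) (simp add: mG_sets)
  then show "emeasure mG (core n) \<noteq> \<infinity>" using mG_H by (auto simp: top_unique)
qed

text \<open>All these characters have the same nonzero inner product with the indicator of
  \<^term>\<open>core n\<close>, so Bessel's inequality bounds their number.\<close>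

lemma finite_level_characters: "finite (level_characters n)"
proof -
  define m where "m = measure mG (core n)"
  have m: "m > 0"
    using emeasure_core[of n] by (simp add: m_def measure_def enn2real_positive_iff less_top zero_less_iff_neq_zero)
  define f :: "'a \<Rightarrow> complex" where "f = indicator (core n)"
  have norm_f: "(\<lambda>x. (cmod (f x))\<^sup>2) = indicator (core n)"
    by (auto simp: f_def indicator_def)
  have "f \<in> borel_measurable mG"
    unfolding f_def by (intro borel_measurable_indicator) (simp add: mG_sets)
  moreover have "integrable mG (indicator (core n) :: 'a \<Rightarrow> real)"
    using emeasure_core[of n] by (intro integrable_real_indicator) (simp_all add: mG_sets less_top)
  ultimately have f: "f \<in> L2 mG"
    unfolding L2_def using norm_f by simp
  have inner: "L2_inner mG f (atom (0, \<xi>)) = m" if "\<xi> \<in> annihilator (core n)" for \<xi>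
  proof -
    have "f y * cnj (atom (0, \<xi>) y) = indicator (core n) y" for y
      using that core_subset[of n]
      by (auto simp: f_def indicator_def atom_def coset_def annihilator_def)
    then have "L2_inner mG f (atom (0, \<xi>)) = (\<integral>y. complex_of_real (indicator (core n) y) \<partial>mG)"
      unfolding L2_inner_def by (intro Bochner_Integration.integral_cong) (auto simp: indicator_def)
    then show ?thesis
      unfolding integral_complex_of_real by (simp add: m_def)
  qed
  have bound: "card X \<le> nat \<lfloor>1 / m\<rfloor>" if X: "X \<subseteq> level_characters n" "finite X" for X
  proof -
    from X obtain D where D: "D \<subseteq> annihilator (core n)" "inj_on (\<lambda>\<xi>. atom (0, \<xi>)) D"
        "X = (\<lambda>\<xi>. atom (0, \<xi>)) ` D"
      unfolding level_characters_def by (meson subset_image_inj)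
    have "finite D" using X(2) D by (simp add: finite_image_iff)
    have "(\<Sum>\<xi>\<in>D. (cmod (L2_inner mG f (atom (0, \<xi>))))\<^sup>2) \<le> (\<integral>x. (cmod (f x))\<^sup>2 \<partial>mG)"
    proof (rule atoms_bessel[OF \<open>finite D\<close> f])
      fix \<xi> \<eta> assume "\<xi> \<in> D" "\<eta> \<in> D" and L: "(0, \<xi>) - (0, \<eta>) \<in> cell"
      have "atom (0, \<xi>) = atom (0, \<eta>)"
        using atom_cong[OF L] by (intro ext) simp
      then show "\<xi> = \<eta>" using D(2) \<open>\<xi> \<in> D\<close> \<open>\<eta> \<in> D\<close> by (auto dest: inj_onD)
    qed
    also have "(\<Sum>\<xi>\<in>D. (cmod (L2_inner mG f (atom (0, \<xi>))))\<^sup>2) = (\<Sum>\<xi>\<in>D. m\<^sup>2)"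
      using D(1) m by (intro sum.cong refl) (simp add: inner subset_iff)
    also have "(\<integral>x. (cmod (f x))\<^sup>2 \<partial>mG) = m"
      unfolding norm_f by (simp add: m_def)
    finally have "real (card D) * m\<^sup>2 \<le> m" by simp
    then have "real (card D) \<le> 1 / m"
      using m by (simp add: field_simps power2_eq_square)
    moreover have "card X = card D" using D by (simp add: card_image)
    ultimately show ?thesis by (simp add: le_nat_floor)
  qed
  show ?thesis
    using finite_if_finite_subsets_card_bdd[of "level_characters n" "nat \<lfloor>1 / m\<rfloor>"] bound by simp
qed

text \<open>Multiplication by one of the characters permutes them all, which forces the sum to
  vanish wherever that character differs from 1.\<close>

lemma sum_level_characters:
  "(\<Sum>u\<in>level_characters n. u y) = of_nat (card (level_characters n)) * indicator (core n) y"
proof -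
  let ?E = "level_characters n"
  consider "y \<in> core n" | "y \<in> H" "y \<notin> core n" | "y \<notin> H" by blast
  then show ?thesis
  proof cases
    case 1
    then have "u y = 1" if "u \<in> ?E" for u
      using that core_subset[of n]
      by (auto simp: level_characters_def atom_def indicator_def coset_def annihilator_def)
    then have "(\<Sum>u\<in>?E. u y) = (\<Sum>u\<in>?E. 1)" by (intro sum.cong refl)
    then show ?thesis using 1 by simp
  next
    case 2
    obtain \<eta> where \<eta>: "\<eta> \<in> annihilator (core n)" "pairing y \<eta> \<noteq> 1"
      using open_subgroup_separated_by_character[OF core_subgroup core_open 2(2)] by (elim bexE)
    \<comment> \<open>the characters of this level form a group under multiplication\<close>
    have mult: "(\<lambda>x. pairing x \<eta>' * u x) \<in> ?E" if u: "u \<in> ?E" and "\<eta>' \<in> annihilator (core n)" for u \<eta>'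
    proof -
      obtain \<xi> where "\<xi> \<in> annihilator (core n)" "u = atom (0, \<xi>)"
        using u by (auto simp: level_characters_def)
      moreover have "(\<lambda>x. pairing x \<eta>' * atom (0, \<xi>) x) = atom (0, \<eta>' + \<xi>)"
        by (simp add: atom_def pairing_add_right mult.assoc fun_eq_iff)
      ultimately show ?thesis
        using add_subgroupD(2)[OF add_subgroup_annihilator] that(2) by (auto simp: level_characters_def)
    qed
    have minus: "- \<eta> \<in> annihilator (core n)"
      using add_subgroupD(3)[OF add_subgroup_annihilator \<eta>(1)] .
    have cancel: "(\<lambda>x. pairing x (- \<eta>) * (pairing x \<eta> * u x)) = u"
        "(\<lambda>x. pairing x \<eta> * (pairing x (- \<eta>) * u x)) = u" for u :: "'a \<Rightarrow> complex"
      unfolding pairing_uminus_right mult.assoc[symmetric] mult.commute[of "pairing _ \<eta>" "cnj (pairing _ \<eta>)"]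
        pairing_cnj by simp_all
    have "(\<Sum>u\<in>?E. pairing y \<eta> * u y) = (\<Sum>u\<in>?E. u y)"
    proof (rule sum.reindex_bij_witness[where
          i = "\<lambda>u x. pairing x (- \<eta>) * u x" and j = "\<lambda>u x. pairing x \<eta> * u x"])
    qed (simp_all only: cancel mult[OF _ \<eta>(1)] mult[OF _ minus])
    then have "(1 - pairing y \<eta>) * (\<Sum>u\<in>?E. u y) = 0"
      unfolding sum_distrib_left[symmetric] left_diff_distrib by simp
    then show ?thesis using \<eta>(2) 2 by simp
  next
    case 3
    then have "u y = 0" if "u \<in> ?E" for u
      using that by (auto simp: level_characters_def atom_def indicator_def coset_def)
    then have "(\<Sum>u\<in>?E. u y) = (\<Sum>u\<in>?E. 0)" by (intro sum.cong refl)
    then show ?thesis using 3 core_subset[of n] by (auto simp: indicator_def)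
  qed
qed

lemma card_level_characters: "card (level_characters n) \<noteq> 0"
  using finite_level_characters[of n] add_subgroupD(1)[OF add_subgroup_annihilator, of "core n"]
  by (auto simp: level_characters_def)

section \<open>Countability of the set of cosets in the time-frequency plane\<close>

text \<open>By continuity a character is close to 1 on some \<^term>\<open>core n\<close>, and
  then it is trivial there because the circle has no small subgroups.\<close>

lemma Union_annihilator_core: "(\<Union>n. annihilator (core n)) = UNIV"
proof -
  have "\<exists>n. \<xi> \<in> annihilator (core n)" for \<xi> :: "'a pdual"
  proof -
    let ?U = "(\<lambda>x. cmod (pairing x \<xi> - 1)) -` {..<1/2}"
    have "continuous_on UNIV (\<lambda>x. cmod (pairing x \<xi> - 1))"
      by (intro continuous_intros continuous_on_pairing)
    then have "open ?U" by (intro open_vimage) simp_all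
    then obtain n where "core n \<subseteq> ?U"
      using core_neighbourhood_base[of ?U] by auto
    then have "\<xi> \<in> annihilator (core n)"
      by (intro annihilatorI_near_one[OF core_subgroup]) auto
    then show ?thesis by (rule exI)
  qed
  then show ?thesis by auto
qed

text \<open>The annihilator of \<^term>\<open>core n\<close> splits into one coset of the
  annihilator of \<^term>\<open>H\<close> for each character of level \<^term>\<open>n\<close>,
  hence into finitely many.\<close>

lemma dual_coset_sequence: "\<exists>r. (\<Union>k::nat. coset (annihilator H) (r k)) = UNIV"
proof -
  have "\<exists>D. finite D \<and> level_characters n = (\<lambda>\<xi>. atom (0, \<xi>)) ` D" for n
    using finite_subset_image[OF finite_level_characters[of n]] unfolding level_characters_def
    by (metis order_refl)
  then have "\<exists>D. \<forall>n. finite (D n) \<and> level_characters n = (\<lambda>\<xi>. atom (0, \<xi>)) ` D n"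
    by (intro choice allI)
  then obtain D where "\<forall>n. finite (D n) \<and> level_characters n = (\<lambda>\<xi>. atom (0, \<xi>)) ` D n"
    by (elim exE)
  then have D: "\<And>n. finite (D n)" "\<And>n. level_characters n = (\<lambda>\<xi>. atom (0, \<xi>)) ` D n"
    by simp_all
  let ?C = "\<Union>n. D n"
  have C: "countable ?C" using D(1) by (simp add: countable_finite)
  have cover: "\<exists>\<eta>\<in>?C. \<xi> \<in> coset (annihilator H) \<eta>" for \<xi>
  proof -
    have "\<xi> \<in> (\<Union>n. annihilator (core n))" using Union_annihilator_core by simp
    then obtain n where "\<xi> \<in> annihilator (core n)" by (elim UN_E)
    then have "atom (0, \<xi>) \<in> level_characters n" by (simp add: level_characters_def)
    then obtain \<eta> where \<eta>: "\<eta> \<in> D n" "atom (0, \<xi>) = atom (0, \<eta>)"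
      unfolding D(2) by (elim imageE)
    have "pairing h (\<xi> - \<eta>) = 1" if "h \<in> H" for h
      using fun_cong[OF \<eta>(2), of h] that pairing_cnj[of h \<eta>]
      by (simp add: atom_def coset_def pairing_diff_right mult.commute)
    then have "\<xi> \<in> coset (annihilator H) \<eta>"
      by (simp add: coset_def annihilator_def)
    then show ?thesis using \<eta>(1) by auto
  qed
  from cover[of 0] have "?C \<noteq> {}" by auto
  have "\<exists>k. \<xi> \<in> coset (annihilator H) (from_nat_into ?C k)" for \<xi>
  proof -
    obtain \<eta> where \<eta>: "\<eta> \<in> ?C" "\<xi> \<in> coset (annihilator H) \<eta>" using cover[of \<xi>] by (elim bexE)
    then have "\<eta> \<in> range (from_nat_into ?C)"
      using range_from_nat_into[OF \<open>?C \<noteq> {}\<close> C] by simp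
    then show ?thesis using \<eta>(2) by auto
  qed
  then have "(\<Union>k. coset (annihilator H) (from_nat_into ?C k)) = UNIV" by auto
  then show ?thesis by (rule exI[of _ "from_nat_into ?C"])
qed

definition dual_rep :: "nat \<Rightarrow> 'a pdual" where
  "dual_rep = (SOME r. (\<Union>k. coset (annihilator H) (r k)) = UNIV)"

lemma dual_rep: "(\<Union>k. coset (annihilator H) (dual_rep k)) = UNIV"
  unfolding dual_rep_def by (rule someI_ex[OF dual_coset_sequence])

sublocale mG: sigma_finite_measure mG
  by (rule haar_sigma_finite[OF mG _ mG_H rep[of 0, simplified]]) (use H_open in simp_all)

sublocale mD: sigma_finite_measure mD
  by (rule haar_sigma_finite[OF mD _ mD_H dual_rep])
    (use open_annihilator[OF H_subgroup H_compact] in simp_all)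

definition plane_rep :: "nat \<Rightarrow> 'a \<times> 'a pdual" where
  "plane_rep n = (rep 0 (fst (prod_decode n)), dual_rep (snd (prod_decode n)))"

lemma plane_rep: "(\<Union>n. coset cell (plane_rep n)) = UNIV"
proof -
  have "\<exists>n. z \<in> coset cell (plane_rep n)" for z
  proof -
    have "fst z \<in> (\<Union>k. coset (core 0) (rep 0 k))" "snd z \<in> (\<Union>k. coset (annihilator H) (dual_rep k))"
      using rep[of 0] dual_rep by simp_all
    then obtain j k where "fst z \<in> coset H (rep 0 j)" "snd z \<in> coset (annihilator H) (dual_rep k)"
      by auto
    then have "z \<in> coset cell (plane_rep (prod_encode (j, k)))"
      by (simp add: coset_def cell_def plane_rep_def mem_Times_iff)
    then show ?thesis by (rule exI)
  qed
  then show ?thesis by auto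
qed

text \<open>The enumeration \<^term>\<open>plane_rep\<close> may meet a coset several times.
  Only the indices in the range of this map are used, and they form a transversal of the cosets.\<close>

definition plane_index :: "'a \<times> 'a pdual \<Rightarrow> nat" where
  "plane_index = coset_index cell plane_rep"

lemma plane_index: "z - plane_rep (plane_index z) \<in> cell"
  unfolding plane_index_def by (rule coset_index[OF plane_rep])

lemma plane_index_eq_iff: "plane_index z = plane_index w \<longleftrightarrow> z - w \<in> cell"
  unfolding plane_index_def by (rule coset_index_cong_iff[OF add_subgroup_cell plane_rep])

lemma plane_index_rep: "n \<in> range plane_index \<Longrightarrow> plane_index (plane_rep n) = n"
proof -
  assume "n \<in> range plane_index"
  then obtain z where n: "n = plane_index z" by auto
  have "plane_index z = plane_index (plane_rep n)"
    unfolding plane_index_eq_iff n by (rule plane_index)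
  then show ?thesis using n by simp
qed

lemma plane_rep_separated:
  "i \<in> range plane_index \<Longrightarrow> j \<in> range plane_index \<Longrightarrow> plane_rep i - plane_rep j \<in> cell \<Longrightarrow> i = j"
  using plane_index_rep plane_index_eq_iff by metis

section \<open>Completeness of the system\<close>

lemma coset_mG [measurable]: "coset H a \<in> sets mG" "coset (core n) a \<in> sets mG"
  by (simp_all add: mG_sets)

lemma Int_stable_cosets: "Int_stable (insert {} {coset (core n) a | n a. True})"
proof -
  have *: "coset (core m) a \<inter> coset (core n) b = {} \<or> coset (core m) a \<inter> coset (core n) b = coset (core n) b"
    if "m \<le> n" for m n a b
  proof (cases "coset (core m) a \<inter> coset (core n) b = {}")
    case False
    then obtain c where "c - a \<in> core m" "c - b \<in> core n" by (auto simp: coset_def)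
    then have "coset (core n) c = coset (core n) b" "coset (core m) c = coset (core m) a"
      using coset_eq[OF core_subgroup] by auto
    moreover have "coset (core n) c \<subseteq> coset (core m) c"
      using core_antimono[OF that] by (auto simp: coset_def)
    ultimately show ?thesis by auto
  qed simp
  let ?G = "insert {} {coset (core n) a | n a. True}"
  have "coset (core m) a \<inter> coset (core n) b \<in> ?G" for m n a b
  proof (cases "m \<le> n")
    case True
    show ?thesis using *[OF True, of a b] by auto
  next
    case False
    then show ?thesis using *[of n m b a] by (auto simp: Int_commute)
  qed
  then show ?thesis
    unfolding Int_stable_def by (intro ballI) (elim insertE CollectE exE conjE; simp)
qed

lemma integrable_mult_atom:
  assumes \<psi>: "\<psi> \<in> borel_measurable mG" and int: "integrable mG (\<lambda>y. indicator (coset H (fst z)) y * \<psi> y)"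
  shows "integrable mG (\<lambda>y. \<psi> y * cnj (atom z y))"
proof (rule Bochner_Integration.integrable_bound[OF int])
  show "(\<lambda>y. \<psi> y * cnj (atom z y)) \<in> borel_measurable mG"
    using \<psi> by measurable
  show "AE y in mG. norm (\<psi> y * cnj (atom z y)) \<le> norm (indicator (coset H (fst z)) y * \<psi> y)"
    by (simp add: norm_mult norm_atom indicator_def)
qed

text \<open>The indicator of a coset of \<^term>\<open>core n\<close> is a linear combination of
  atoms, by the formula for the sum of the characters of level \<^term>\<open>n\<close>.\<close>

lemma integral_core_coset:
  assumes \<psi>: "\<psi> \<in> borel_measurable mG" "\<And>a. integrable mG (\<lambda>y. indicator (coset H a) y * \<psi> y)"
    and orth: "\<And>z. L2_inner mG \<psi> (atom z) = 0"
  shows "(\<integral>y. indicator (coset (core n) a) y * \<psi> y \<partial>mG) = 0"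
proof -
  let ?E = "level_characters n"
  have shifted: "\<exists>c z. fst z = a \<and> (\<forall>y. u (y - a) = c * cnj (atom z y))" if u: "u \<in> ?E" for u
  proof -
    obtain \<xi> where "u = atom (0, \<xi>)" using u by (auto simp: level_characters_def)
    then have "u (y - a) = cnj (pairing a \<xi>) * cnj (atom (a, - \<xi>) y)" for y
      by (simp add: atom_def pairing_diff_left pairing_uminus_right coset_def indicator_def)
    then show ?thesis by (intro exI[of _ "cnj (pairing a \<xi>)"] exI[of _ "(a, - \<xi>)"]) simp
  qed
  have int: "integrable mG (\<lambda>y. u (y - a) * \<psi> y)" and zero: "(\<integral>y. u (y - a) * \<psi> y \<partial>mG) = 0"
    if u: "u \<in> ?E" for u
  proof -
    obtain c z where "fst z = a" "\<forall>y. u (y - a) = c * cnj (atom z y)"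
      using shifted[OF u] by (elim exE conjE)
    then have z: "fst z = a" "\<And>y. u (y - a) = c * cnj (atom z y)" by simp_all
    have eq: "(\<lambda>y. u (y - a) * \<psi> y) = (\<lambda>y. c * (\<psi> y * cnj (atom z y)))"
      by (simp add: z(2) fun_eq_iff)
    show "integrable mG (\<lambda>y. u (y - a) * \<psi> y)"
      unfolding eq by (intro integrable_mult_right integrable_mult_atom \<psi>)
    show "(\<integral>y. u (y - a) * \<psi> y \<partial>mG) = 0"
      unfolding eq integral_mult_right_zero using orth[of z] by (simp add: L2_inner_def)
  qed
  have "of_nat (card ?E) * (\<integral>y. indicator (coset (core n) a) y * \<psi> y \<partial>mG)
      = (\<integral>y. of_nat (card ?E) * (indicator (coset (core n) a) y * \<psi> y) \<partial>mG)"
    by (rule integral_mult_right_zero[symmetric])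
  also have "\<dots> = (\<integral>y. (\<Sum>u\<in>?E. u (y - a) * \<psi> y) \<partial>mG)"
  proof (intro Bochner_Integration.integral_cong refl)
    fix y
    have "(\<Sum>u\<in>?E. u (y - a) * \<psi> y) = (\<Sum>u\<in>?E. u (y - a)) * \<psi> y"
      by (rule sum_distrib_right[symmetric])
    also have "\<dots> = of_nat (card ?E) * indicator (core n) (y - a) * \<psi> y"
      unfolding sum_level_characters ..
    finally show "of_nat (card ?E) * (indicator (coset (core n) a) y * \<psi> y) = (\<Sum>u\<in>?E. u (y - a) * \<psi> y)"
      by (simp add: indicator_def coset_def)
  qed
  also have "\<dots> = (\<Sum>u\<in>?E. \<integral>y. u (y - a) * \<psi> y \<partial>mG)"
    by (rule Bochner_Integration.integral_sum) (rule int)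
  also have "\<dots> = 0"
    by (rule sum.neutral) (use zero in blast)
  finally show ?thesis using card_level_characters[of n] by simp
qed

text \<open>The integrals over all cosets of the subgroups \<^term>\<open>core n\<close> vanish.
  These cosets generate the Borel sets and are closed under nonempty intersections, so all
  integrals over Borel subsets of a coset of \<^term>\<open>H\<close> vanish as well. Local
  integrability is the right generality because the theorem is later applied to the difference
  of a square integrable function and the sum of a series that is only known to be bounded.\<close>

theorem atoms_complete:
  assumes \<psi>: "\<psi> \<in> borel_measurable mG" "\<And>a. integrable mG (\<lambda>y. indicator (coset H a) y * \<psi> y)"
    and orth: "\<And>z. L2_inner mG \<psi> (atom z) = 0"
  shows "AE y in mG. \<psi> y = 0"
proof -
  have on_coset: "AE y in mG. indicator (coset H a) y * \<psi> y = 0" for a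
  proof -
    let ?f = "\<lambda>y. indicator (coset H a) y * \<psi> y"
    have subset_Pow: "insert {} {coset (core n) a | n a. True} \<subseteq> Pow UNIV" by simp
    have cut: "integrable mG (\<lambda>y. indicator B y *\<^sub>R ?f y)" if "B \<in> sets borel" for B
      using \<psi>(2) that by (intro integrable_mult_indicator) (simp_all add: mG_sets)
    have zero: "(\<integral>y. indicator B y *\<^sub>R ?f y \<partial>mG) = 0" if "B \<in> sets borel" for B
    proof -
      have "B \<in> sigma_sets UNIV (insert {} {coset (core n) a | n a. True})"
        using that borel_eq_sigma_cosets by simp
      with Int_stable_cosets subset_Pow show ?thesis
      proof (induction B rule: sigma_sets_induct_disjoint)
        case (basic C)
        show ?case
        proof (cases "C = {}")
          case False
          then obtain n b where C: "C = coset (core n) b" using basic by auto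
          show ?thesis
          proof (cases "b - a \<in> H")
            case True
            have "C \<subseteq> coset H b"
              using core_subset[of n] by (auto simp: C coset_def)
            then have "C \<subseteq> coset H a"
              by (simp only: coset_eq[OF H_subgroup True])
            then have "(\<lambda>y. indicator C y *\<^sub>R ?f y) = (\<lambda>y. indicator (coset (core n) b) y * \<psi> y)"
              by (auto simp: C indicator_def fun_eq_iff)
            then show ?thesis using integral_core_coset[OF \<psi> orth] by simp
          next
            case False
            have "y - a \<notin> H" if "y \<in> C" for y
              using that add_subgroup_diff[OF H_subgroup, of "y - a" "y - b"] core_subset[of n] False
              by (auto simp: C coset_def)
            then have "(\<lambda>y. indicator C y *\<^sub>R ?f y) = (\<lambda>y. 0)"
              by (auto simp: indicator_def coset_def fun_eq_iff)
            then show ?thesis by simp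
          qed
        qed simp
      next
        case empty
        show ?case by simp
      next
        case (compl C)
        have C: "C \<in> sets borel" using compl(1) borel_eq_sigma_cosets by simp
        have "(\<lambda>y. indicator (UNIV - C) y *\<^sub>R ?f y) = (\<lambda>y. indicator (coset (core 0) a) y * \<psi> y - indicator C y *\<^sub>R ?f y)"
          by (auto simp: indicator_def fun_eq_iff)
        then show ?case
          using Bochner_Integration.integral_diff[OF _ cut[OF C], of "\<lambda>y. indicator (coset (core 0) a) y * \<psi> y"]
            \<psi>(2) compl.IH integral_core_coset[OF \<psi> orth, of 0 a] by simp
      next
        case (union C)
        have C: "C i \<in> sets mG" for i
          using union(2) by (auto simp: mG_sets borel_eq_sigma_cosets)
        have "(\<Union>i. C i) \<in> sets borel"
          using C by (auto simp: mG_sets)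
        then have "set_integrable mG (\<Union>i. C i) ?f"
          unfolding set_integrable_def by (rule cut)
        then have "(\<integral>x\<in>(\<Union>i. C i). ?f x \<partial>mG) = (\<Sum>i. (\<integral>x\<in>C i. ?f x \<partial>mG))"
          using union(1) C by (intro lebesgue_integral_countable_add) (auto simp: disjoint_family_on_def)
        then show ?case
          using union(3) by (simp add: set_lebesgue_integral_def)
      qed
    qed
    show "AE y in mG. ?f y = 0"
      by (rule mG.density_zero) (use \<psi>(2) zero in \<open>simp_all add: set_lebesgue_integral_def mG_sets\<close>)
  qed
  have "AE y in mG. \<forall>k. indicator (coset H (rep 0 k)) y * \<psi> y = 0"
    unfolding AE_all_countable using on_coset by blast
  then show ?thesis
  proof (rule AE_mp, intro AE_I2 impI)
    fix y assume y: "\<forall>k. indicator (coset H (rep 0 k)) y * \<psi> y = 0"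
    have "y \<in> (\<Union>k. coset (core 0) (rep 0 k))" using rep[of 0] by simp
    then obtain k where "y \<in> coset H (rep 0 k)" by auto
    then show "\<psi> y = 0" using y[rule_format, of k] by simp
  qed
qed

lemma L2_integrable_coset:
  assumes "f \<in> L2 mG"
  shows "integrable mG (\<lambda>y. indicator (coset H a) y * f y)"
proof -
  have "(\<lambda>y. f y * cnj (atom (a, 0) y)) = (\<lambda>y. indicator (coset H a) y * f y)"
    by (auto simp: atom_def indicator_def)
  then show ?thesis using L2_mult_integrable[OF assms atom_L2[of "(a, 0)"]] by simp
qed

section \<open>Summability of the coefficients\<close>

lemma pairing_compose_measurable [measurable (raw)]:
  "f \<in> measurable M mG \<Longrightarrow> (\<lambda>x. pairing (f x) \<xi>) \<in> borel_measurable M"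
  "g \<in> measurable M mD \<Longrightarrow> (\<lambda>x. pairing y (g x)) \<in> borel_measurable M"
  using measurable_compose[of f M mG "\<lambda>y. pairing y \<xi>" borel] measurable_compose[of g M mD "pairing y" borel]
  by (simp_all add: measurable_cong_sets[OF mG_sets refl] measurable_cong_sets[OF mD_sets refl])

lemma annihilator_coset_mD [measurable]: "coset (annihilator H) \<beta> \<in> sets mD"
  by (simp add: mD_sets)

text \<open>For \<^term>\<open>\<xi>\<close> in a fixed coset of the annihilator, the value
  depends on \<^term>\<open>y\<close> only through its value at \<^term>\<open>\<beta>\<close>
  and the coset of \<^term>\<open>y\<close> modulo \<^term>\<open>H\<close>, which takes
  countably many values.\<close>

lemma pairing_jointly_measurable:
  "(\<lambda>(y, \<xi>). indicator (coset (annihilator H) \<beta>) \<xi> * pairing y \<xi>) \<in> borel_measurable (mG \<Otimes>\<^sub>M mD)"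
proof -
  let ?k = "coset_index H (rep 0)"
  have cover: "(\<Union>k. coset H (rep 0 k)) = UNIV"
    using rep[of 0] by simp
  have eq: "indicator (coset (annihilator H) \<beta>) \<xi> * pairing y \<xi> =
      indicator (coset (annihilator H) \<beta>) \<xi> *
        (pairing y \<beta> * (pairing (rep 0 (?k y)) \<xi> * cnj (pairing (rep 0 (?k y)) \<beta>)))" for y \<xi>
  proof (cases "\<xi> \<in> coset (annihilator H) \<beta>")
    case True
    have "pairing (y - rep 0 (?k y)) (\<xi> - \<beta>) = 1"
      using True coset_index[OF cover, of y] by (simp add: coset_def annihilator_def)
    then have "pairing (rep 0 (?k y) + (y - rep 0 (?k y))) (\<xi> - \<beta>) = pairing (rep 0 (?k y)) (\<xi> - \<beta>)"
      unfolding pairing_add_left by simp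
    then have "pairing y (\<xi> - \<beta>) = pairing (rep 0 (?k y)) (\<xi> - \<beta>)" by simp
    moreover have "pairing y (\<beta> + (\<xi> - \<beta>)) = pairing y \<beta> * pairing y (\<xi> - \<beta>)"
      by (rule pairing_add_right)
    ultimately show ?thesis by (simp add: pairing_diff_right)
  qed simp
  have [measurable]: "?k \<in> measurable mG (count_space UNIV)"
    using measurable_coset_index[OF H_subgroup H_open, of "rep 0"]
    by (simp add: measurable_cong_sets[OF mG_sets refl])
  have "(\<lambda>p. (\<lambda>k p. indicator (coset (annihilator H) \<beta>) (snd p) *
        (pairing (fst p) \<beta> * (pairing (rep 0 k) (snd p) * cnj (pairing (rep 0 k) \<beta>)))) (?k (fst p)) p)
      \<in> borel_measurable (mG \<Otimes>\<^sub>M mD)"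
    by (rule measurable_compose_countable) measurable
  then show ?thesis
    by (simp add: case_prod_unfold eq)
qed

text \<open>Integrating the Fourier transform of \<^term>\<open>F\<close> against the phase
  \<^term>\<open>pairing a\<close> over a coset of the annihilator and exchanging the integrals
  cuts \<^term>\<open>F\<close> off to the coset of \<^term>\<open>a\<close>.\<close>

lemma fourier_coset_bound:
  assumes F: "integrable mG F"
  shows "ennreal (cmod (\<integral>y. indicator (coset H a) y * (F y * cnj (pairing y \<beta>)) \<partial>mG))
    \<le> (\<integral>\<^sup>+\<xi>. indicator (coset (annihilator H) \<beta>) \<xi> * ennreal (cmod (\<integral>y. F y * cnj (pairing y \<xi>) \<partial>mG)) \<partial>mD)"
proof -
  interpret P: pair_sigma_finite mG mD ..
  let ?I = "indicator (coset (annihilator H) \<beta>) :: 'a pdual \<Rightarrow> complex"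
  define K where "K y \<xi> = F y * (pairing a \<xi> * cnj (?I \<xi> * pairing y \<xi>))" for y \<xi>
  note [measurable] = borel_measurable_integrable[OF F] pairing_jointly_measurable[of \<beta>]
  have meas: "case_prod K \<in> borel_measurable (mG \<Otimes>\<^sub>M mD)"
  proof -
    have "(\<lambda>p. F (fst p) * (pairing a (snd p) * cnj ((\<lambda>(y, \<xi>). ?I \<xi> * pairing y \<xi>) p)))
        \<in> borel_measurable (mG \<Otimes>\<^sub>M mD)" by measurable
    then show ?thesis by (simp add: K_def case_prod_unfold)
  qed
  have norm_K: "cmod (K y \<xi>) = cmod (F y) * indicator (coset (annihilator H) \<beta>) \<xi>" for y \<xi>
    by (simp add: K_def norm_mult indicator_def)
  have I: "integrable mD (indicator (coset (annihilator H) \<beta>) :: 'a pdual \<Rightarrow> real)"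
    using emeasure_dual_coset[of \<beta>] by (intro integrable_real_indicator) (simp_all add: mD_sets)
  have "measure mD (coset (annihilator H) \<beta>) = 1"
    using emeasure_dual_coset[of \<beta>] by (simp add: measure_def)
  then have norm_int: "(\<integral>\<xi>. cmod (K y \<xi>) \<partial>mD) = cmod (F y)" for y
    by (simp add: norm_K)
  have int_K: "integrable mD (K y)" for y
  proof (rule Bochner_Integration.integrable_bound)
    show "integrable mD (\<lambda>\<xi>. cmod (F y) * indicator (coset (annihilator H) \<beta>) \<xi>)"
      using I by (rule integrable_mult_right)
    show "K y \<in> borel_measurable mD"
      using measurable_Pair2[OF meas, of y] by simp
  qed (simp add: norm_K)
  have K: "integrable (mG \<Otimes>\<^sub>M mD) (case_prod K)"
    by (rule P.Fubini_integrable[OF meas]) (simp_all add: norm_int int_K F integrable_norm)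
  have inner1: "(\<integral>y. K y \<xi> \<partial>mG) = ?I \<xi> * pairing a \<xi> * (\<integral>y. F y * cnj (pairing y \<xi>) \<partial>mG)" for \<xi>
  proof -
    have "(\<integral>y. K y \<xi> \<partial>mG) = (\<integral>y. (?I \<xi> * pairing a \<xi>) * (F y * cnj (pairing y \<xi>)) \<partial>mG)"
      by (intro Bochner_Integration.integral_cong) (simp_all add: K_def indicator_def)
    then show ?thesis by (simp only: integral_mult_right_zero)
  qed
  have inner2: "(\<integral>\<xi>. K y \<xi> \<partial>mD)
      = pairing a \<beta> * (indicator (coset H a) y * (F y * cnj (pairing y \<beta>)))" for y
  proof -
    have "(\<integral>\<xi>. K y \<xi> \<partial>mD) = (\<integral>\<xi>. F y * (?I \<xi> * pairing (a - y) \<xi>) \<partial>mD)"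
      by (intro Bochner_Integration.integral_cong) (simp_all add: K_def indicator_def pairing_diff_left)
    also have "\<dots> = F y * (if a - y \<in> H then pairing (a - y) \<beta> else 0)"
      by (simp only: integral_mult_right_zero integral_pairing_dual)
    also have "a - y \<in> H \<longleftrightarrow> y \<in> coset H a"
      using add_subgroupD(3)[OF H_subgroup, of "a - y"] add_subgroupD(3)[OF H_subgroup, of "y - a"]
      by (auto simp: coset_def)
    finally show ?thesis by (simp add: pairing_diff_left indicator_def)
  qed
  have "pairing a \<beta> * (\<integral>y. indicator (coset H a) y * (F y * cnj (pairing y \<beta>)) \<partial>mG)
      = (\<integral>y. (\<integral>\<xi>. K y \<xi> \<partial>mD) \<partial>mG)"
    by (simp only: inner2 integral_mult_right_zero)
  also have "\<dots> = (\<integral>\<xi>. (\<integral>y. K y \<xi> \<partial>mG) \<partial>mD)"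
    by (rule P.Fubini_integral[OF K, symmetric])
  finally have swap: "pairing a \<beta> * (\<integral>y. indicator (coset H a) y * (F y * cnj (pairing y \<beta>)) \<partial>mG)
      = (\<integral>\<xi>. (\<integral>y. K y \<xi> \<partial>mG) \<partial>mD)" .
  have "cmod (\<integral>y. indicator (coset H a) y * (F y * cnj (pairing y \<beta>)) \<partial>mG)
      = cmod (\<integral>\<xi>. (\<integral>y. K y \<xi> \<partial>mG) \<partial>mD)"
    unfolding swap[symmetric] by (simp only: norm_mult norm_pairing mult_1)
  also have "ennreal \<dots> \<le> (\<integral>\<^sup>+\<xi>. ennreal (cmod (\<integral>y. K y \<xi> \<partial>mG)) \<partial>mD)"
    by (rule integral_norm_bound_ennreal[OF P.integrable_snd[OF K]])
  also have "\<dots> = (\<integral>\<^sup>+\<xi>. indicator (coset (annihilator H) \<beta>) \<xi> * ennreal (cmod (\<integral>y. F y * cnj (pairing y \<xi>) \<partial>mG)) \<partial>mD)"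
    by (intro nn_integral_cong) (simp add: inner1 norm_mult indicator_def)
  finally show ?thesis .
qed

text \<open>After the substitution of \<^term>\<open>u + x\<close> for \<^term>\<open>y\<close>
  the double integral is a product, because \<^term>\<open>u + x\<close> runs through the coset
  of \<^term>\<open>a\<close> when \<^term>\<open>u\<close> and \<^term>\<open>x\<close> run
  through those of \<^term>\<open>c\<close> and \<^term>\<open>a - c\<close>.\<close>

lemma convolution_coset_bound:
  fixes p q :: "'a \<Rightarrow> complex"
  assumes p: "p \<in> borel_measurable mG" "\<And>a. integrable mG (\<lambda>y. indicator (coset H a) y * p y)"
    and q: "q \<in> borel_measurable mG" "\<And>a. integrable mG (\<lambda>y. indicator (coset H a) y * q y)"
  shows "ennreal (cmod (\<integral>y. indicator (coset H a) y * p y \<partial>mG) * cmod (\<integral>u. indicator (coset H c) u * q u \<partial>mG))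
    \<le> (\<integral>\<^sup>+x. indicator (coset H (a - c)) x *
          ennreal (cmod (\<integral>y. indicator (coset H a) y * (p y * q (y - x)) \<partial>mG)) \<partial>mG)"
proof -
  interpret P: pair_sigma_finite mG mG ..
  let ?C = "\<lambda>a y. indicator (coset H a) y :: complex"
  define J where "J u x = (?C c u * q u) * (?C (a - c) x * p (u + x))" for u x
  \<comment> \<open>the two ways of writing the cutoff, needed for the two orders of integration\<close>
  have coset_sum: "?C c u * ?C (a - c) x = ?C c u * ?C a (u + x)" for u x
  proof (cases "u - c \<in> H")
    case True
    have "x - (a - c) \<in> H \<longleftrightarrow> u + x - a \<in> H"
      using add_subgroupD(2)[OF H_subgroup True, of "x - (a - c)"]
        add_subgroup_diff[OF H_subgroup _ True, of "u + x - a"] by (auto simp: algebra_simps)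
    then show ?thesis by (simp add: indicator_def coset_def)
  qed (simp add: coset_def)
  have J1: "J u x = (?C c u * q u) * (?C a (u + x) * p (u + x))" for u x
  proof -
    have "J u x = (?C c u * ?C (a - c) x) * (q u * p (u + x))"
      unfolding J_def by (simp only: mult_ac)
    also have "\<dots> = (?C c u * ?C a (u + x)) * (q u * p (u + x))"
      by (simp only: coset_sum)
    finally show ?thesis by (simp only: mult_ac)
  qed
  have J2: "J u x = ?C (a - c) x * (?C a (u + x) * (p (u + x) * q u))" for u x
  proof -
    have "?C (a - c) x * ?C c u = ?C (a - c) x * ?C a (u + x)"
    proof (cases "x - (a - c) \<in> H")
      case True
      have "u - c \<in> H \<longleftrightarrow> u + x - a \<in> H"
        using add_subgroupD(2)[OF H_subgroup True, of "u - c"]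
          add_subgroup_diff[OF H_subgroup _ True, of "u + x - a"] by (auto simp: algebra_simps)
      then show ?thesis by (simp add: indicator_def coset_def)
    qed (simp add: coset_def)
    note coset_diff = this
    have "J u x = (?C (a - c) x * ?C c u) * (p (u + x) * q u)"
      unfolding J_def by (simp only: mult_ac)
    also have "\<dots> = (?C (a - c) x * ?C a (u + x)) * (p (u + x) * q u)"
      by (simp only: coset_diff)
    finally show ?thesis by (simp only: mult_ac)
  qed
  note [measurable] = p(1) q(1)
  have add[measurable]: "(\<lambda>z. fst z + snd z) \<in> measurable (mG \<Otimes>\<^sub>M mG) mG"
    using measurable_group_add
    by (simp add: case_prod_unfold measurable_cong_sets[OF sets_pair_measure_cong[OF mG_sets mG_sets] mG_sets])
  have meas: "case_prod J \<in> borel_measurable (mG \<Otimes>\<^sub>M mG)"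
  proof -
    have "(\<lambda>z. (?C c (fst z) * q (fst z)) * (?C (a - c) (snd z) * p (fst z + snd z))) \<in> borel_measurable (mG \<Otimes>\<^sub>M mG)"
      by measurable
    then show ?thesis by (simp add: J_def case_prod_unfold)
  qed
  have tr: "integrable mG (\<lambda>x. ?C a (u + x) * p (u + x))" for u
    by (rule haar_integrable_translation[OF mG p(2)])
  have tr_int: "(\<integral>x. ?C a (u + x) * p (u + x) \<partial>mG) = (\<integral>x. ?C a x * p x \<partial>mG)" for u
    by (rule haar_integral_translation[OF mG borel_measurable_integrable[OF p(2)]])
  have tr_norm: "(\<integral>x. cmod (?C a (u + x) * p (u + x)) \<partial>mG) = (\<integral>x. cmod (?C a x * p x) \<partial>mG)" for u
    by (rule haar_integral_translation[OF mG]) measurable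
  have J: "integrable (mG \<Otimes>\<^sub>M mG) (case_prod J)"
  proof (rule P.Fubini_integrable[OF meas])
    have "(\<lambda>u. \<integral>x. cmod (J u x) \<partial>mG) = (\<lambda>u. cmod (?C c u * q u) * (\<integral>x. cmod (?C a x * p x) \<partial>mG))"
      unfolding J1 norm_mult[of "?C c _ * q _"] integral_mult_right_zero tr_norm ..
    then show "integrable mG (\<lambda>u. \<integral>x. cmod (case_prod J (u, x)) \<partial>mG)"
      using integrable_norm[OF q(2)[of c]] by simp
    show "AE u in mG. integrable mG (\<lambda>x. case_prod J (u, x))"
      unfolding case_prod_conv J1 using tr by (intro AE_I2 integrable_mult_right)
  qed
  have "(\<integral>y. ?C a y * p y \<partial>mG) * (\<integral>u. ?C c u * q u \<partial>mG) = (\<integral>u. (\<integral>x. J u x \<partial>mG) \<partial>mG)"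
    unfolding J1 integral_mult_right_zero tr_int integral_mult_left_zero by (rule mult.commute)
  also have "\<dots> = (\<integral>x. (\<integral>u. J u x \<partial>mG) \<partial>mG)"
    by (rule P.Fubini_integral[OF J, symmetric])
  finally have "ennreal (cmod (\<integral>y. ?C a y * p y \<partial>mG) * cmod (\<integral>u. ?C c u * q u \<partial>mG))
      = ennreal (cmod (\<integral>x. (\<integral>u. J u x \<partial>mG) \<partial>mG))"
    by (simp flip: norm_mult)
  also have "\<dots> \<le> (\<integral>\<^sup>+x. ennreal (cmod (\<integral>u. J u x \<partial>mG)) \<partial>mG)"
    by (rule integral_norm_bound_ennreal[OF P.integrable_snd[OF J]])
  also have "\<dots> = (\<integral>\<^sup>+x. indicator (coset H (a - c)) x *
      ennreal (cmod (\<integral>y. ?C a y * (p y * q (y - x)) \<partial>mG)) \<partial>mG)"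
  proof (intro nn_integral_cong)
    fix x
    have "(\<lambda>y. y - x) \<in> measurable mG mG"
      using haar_measurable_translation[OF mG, of "- x"] by simp
    from measurable_compose[OF this q(1)] have [measurable]: "(\<lambda>y. q (y - x)) \<in> borel_measurable mG" .
    have "(\<integral>u. ?C a (u + x) * (p (u + x) * q u) \<partial>mG) = (\<integral>y. ?C a y * (p y * q (y - x)) \<partial>mG)"
      using haar_integral_translation[OF mG, of "\<lambda>y. ?C a y * (p y * q (y - x))" x]
      by (simp add: add.commute)
    then have "(\<integral>u. J u x \<partial>mG) = ?C (a - c) x * (\<integral>y. ?C a y * (p y * q (y - x)) \<partial>mG)"
      unfolding J2 by simp
    then show "ennreal (cmod (\<integral>u. J u x \<partial>mG)) = indicator (coset H (a - c)) x *
        ennreal (cmod (\<integral>y. ?C a y * (p y * q (y - x)) \<partial>mG))"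
      by (simp add: norm_mult indicator_def)
  qed
  finally show ?thesis .
qed

lemma L2_translation:
  assumes g: "g \<in> L2 mG"
  shows "(\<lambda>y. g (y - x)) \<in> L2 mG"
proof -
  have "(\<lambda>y. y - x) \<in> measurable mG mG"
    using haar_measurable_translation[OF mG, of "- x"] by simp
  from measurable_compose[OF this L2_measurable[OF g]]
  have "(\<lambda>y. g (y - x)) \<in> borel_measurable mG" .
  moreover have "integrable mG (\<lambda>y. (cmod (g (y - x)))\<^sup>2)"
    using haar_integrable_translation[OF mG L2_integrable[OF g], of "- x"] by simp
  ultimately show ?thesis by (simp add: L2_def)
qed

lemma time_frequency_shift_eq: "time_frequency_shift z f y = pairing y (snd z) * f (y - fst z)"
  by (simp add: time_frequency_shift_def modulation_def translation_def)

lemma L2_time_frequency_shift: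
  assumes f: "f \<in> L2 mG"
  shows "time_frequency_shift z f \<in> L2 mG"
proof -
  note f' = L2_translation[OF f, of "fst z"]
  have "(\<lambda>y. pairing y (snd z) * f (y - fst z)) \<in> borel_measurable mG"
    using L2_measurable[OF f'] by measurable
  then show ?thesis
    using L2_integrable[OF f'] by (simp add: L2_def time_frequency_shift_eq[abs_def] norm_mult)
qed

text \<open>A local form of the formula that recovers a short-time Fourier transform with a new
  window by convolution. The new window is the indicator of \<^term>\<open>H\<close>; since its
  own transform is supported on the cell, the transform with window \<^term>\<open>g\<close>
  enters only through a single coset. The coset bounds above handle the frequency variable and
  then the time variable.\<close>

lemma coefficient_bound:
  assumes f: "f \<in> L2 mG" and g: "g \<in> L2 mG" and V: "STFT mG g f \<in> borel_measurable (mG \<Otimes>\<^sub>M mD)"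
  shows "ennreal (cmod (L2_inner mG f (atom w)) * cmod (L2_inner mG g (atom z)))
    \<le> (\<integral>\<^sup>+v. indicator (coset cell (w - z)) v * ennreal (cmod (STFT mG g f v)) \<partial>(mG \<Otimes>\<^sub>M mD))"
proof -
  define a where "a = fst w"
  define c where "c = fst z"
  define \<beta> where "\<beta> = snd w - snd z"
  define p where "p y = f y * cnj (pairing y (snd w))" for y
  define q where "q u = cnj (g u) * pairing u (snd z)" for u
  have wz: "coset cell (w - z) = coset H (a - c) \<times> coset (annihilator H) \<beta>"
    by (auto simp: coset_def cell_def a_def c_def \<beta>_def mem_Times_iff)
  have meas: "p \<in> borel_measurable mG" "q \<in> borel_measurable mG"
    unfolding p_def q_def using L2_measurable[OF f] L2_measurable[OF g] by measurable
  have norm_p: "cmod (p y) = cmod (f y)" and norm_q: "cmod (q y) = cmod (g y)" for y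
    by (simp_all add: p_def q_def norm_mult)
  have p_int: "integrable mG (\<lambda>y. indicator (coset H d) y * p y)" for d
    by (rule Bochner_Integration.integrable_bound[OF L2_integrable_coset[OF f, of d]])
      (use meas in \<open>auto simp: norm_p norm_mult\<close>)
  have q_int: "integrable mG (\<lambda>y. indicator (coset H d) y * q y)" for d
    by (rule Bochner_Integration.integrable_bound[OF L2_integrable_coset[OF g, of d]])
      (use meas in \<open>auto simp: norm_q norm_mult\<close>)
  have pw: "(\<integral>y. indicator (coset H a) y * p y \<partial>mG) = L2_inner mG f (atom w)"
    unfolding L2_inner_def
    by (intro Bochner_Integration.integral_cong) (simp_all add: p_def atom_def a_def indicator_def)
  have "(\<integral>u. indicator (coset H c) u * q u \<partial>mG) = (\<integral>u. cnj (g u * cnj (atom z u)) \<partial>mG)"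
    by (intro Bochner_Integration.integral_cong) (simp_all add: q_def atom_def c_def indicator_def)
  also have "\<dots> = cnj (L2_inner mG g (atom z))"
    unfolding L2_inner_def by (rule Bochner_Integration.integral_cnj)
  finally have qz: "(\<integral>u. indicator (coset H c) u * q u \<partial>mG) = cnj (L2_inner mG g (atom z))" .
  have slice: "ennreal (cmod (\<integral>y. indicator (coset H a) y * (p y * q (y - x)) \<partial>mG))
      \<le> (\<integral>\<^sup>+\<xi>. indicator (coset (annihilator H) \<beta>) \<xi> * ennreal (cmod (STFT mG g f (x, \<xi>))) \<partial>mD)" for x
  proof -
    \<comment> \<open>for fixed time the transform is the Fourier transform of this integrable function\<close>
    define F where "F y = f y * cnj (g (y - x))" for y
    have F: "integrable mG F"
      unfolding F_def by (rule L2_mult_integrable[OF f L2_translation[OF g]])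
    have "p y * q (y - x) = cnj (pairing x (snd z)) * (F y * cnj (pairing y \<beta>))" for y
      by (simp add: p_def q_def F_def \<beta>_def pairing_diff_left pairing_diff_right mult_ac)
    then have "(\<integral>y. indicator (coset H a) y * (p y * q (y - x)) \<partial>mG)
        = (\<integral>y. cnj (pairing x (snd z)) * (indicator (coset H a) y * (F y * cnj (pairing y \<beta>))) \<partial>mG)"
      by (simp only: mult.left_commute)
    also have "\<dots> = cnj (pairing x (snd z)) * (\<integral>y. indicator (coset H a) y * (F y * cnj (pairing y \<beta>)) \<partial>mG)"
      by (rule integral_mult_right_zero)
    finally have "cmod (\<integral>y. indicator (coset H a) y * (p y * q (y - x)) \<partial>mG)
        = cmod (\<integral>y. indicator (coset H a) y * (F y * cnj (pairing y \<beta>)) \<partial>mG)"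
      by (simp only: norm_mult complex_mod_cnj norm_pairing mult_1)
    moreover have "STFT mG g f (x, \<xi>) = (\<integral>y. F y * cnj (pairing y \<xi>) \<partial>mG)" for \<xi>
      by (simp add: STFT_def L2_inner_def time_frequency_shift_eq F_def mult_ac)
    ultimately show ?thesis using fourier_coset_bound[OF F, of a \<beta>] by simp
  qed
  have [measurable]: "coset cell (w - z) \<in> sets (mG \<Otimes>\<^sub>M mD)"
    unfolding wz by (rule pair_measureI) measurable
  note [measurable] = V
  have "ennreal (cmod (L2_inner mG f (atom w)) * cmod (L2_inner mG g (atom z)))
      \<le> (\<integral>\<^sup>+x. indicator (coset H (a - c)) x *
          ennreal (cmod (\<integral>y. indicator (coset H a) y * (p y * q (y - x)) \<partial>mG)) \<partial>mG)"
    using convolution_coset_bound[OF meas(1) p_int meas(2) q_int, of a c] unfolding pw qz by simp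
  also have "\<dots> \<le> (\<integral>\<^sup>+x. indicator (coset H (a - c)) x *
      (\<integral>\<^sup>+\<xi>. indicator (coset (annihilator H) \<beta>) \<xi> * ennreal (cmod (STFT mG g f (x, \<xi>))) \<partial>mD) \<partial>mG)"
    by (intro nn_integral_mono mult_left_mono slice) simp
  also have "\<dots> = (\<integral>\<^sup>+x. \<integral>\<^sup>+\<xi>. indicator (coset cell (w - z)) (x, \<xi>) * ennreal (cmod (STFT mG g f (x, \<xi>))) \<partial>mD \<partial>mG)"
    by (intro nn_integral_cong) (simp add: wz indicator_def)
  also have "\<dots> = (\<integral>\<^sup>+v. indicator (coset cell (w - z)) v * ennreal (cmod (STFT mG g f v)) \<partial>(mG \<Otimes>\<^sub>M mD))"
    by (rule mD.nn_integral_fst) measurable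
  finally show ?thesis .
qed

text \<open>By completeness some coefficient of \<^term>\<open>g\<close> is nonzero. With that
  one fixed, the cosets that bound the coefficients of \<^term>\<open>f\<close> are pairwise
  disjoint, so the sum is controlled by the integral of the short-time Fourier transform over
  the whole plane.\<close>

lemma coefficients_bounded_sums:
  assumes g: "admissible_window mG mD g" and f: "f \<in> modulation_space_M1 mG mD g"
  shows "\<exists>S. \<forall>F\<subseteq>range plane_index. finite F \<longrightarrow> (\<Sum>n\<in>F. cmod (L2_inner mG f (atom (plane_rep n)))) \<le> S"
proof -
  have gL2: "g \<in> L2 mG" and gnz: "nonzero_L2 mG g"
    using g by (simp_all add: admissible_window_def)
  have fL2: "f \<in> L2 mG" and V: "integrable (mG \<Otimes>\<^sub>M mD) (STFT mG g f)"
    using f by (simp_all add: modulation_space_M1_def)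
  have "\<exists>z. L2_inner mG g (atom z) \<noteq> 0"
  proof (rule ccontr)
    assume "\<nexists>z. L2_inner mG g (atom z) \<noteq> 0"
    then have "L2_inner mG g (atom z) = 0" for z by blast
    then have "AE y in mG. g y = 0"
      by (rule atoms_complete[OF L2_measurable[OF gL2] L2_integrable_coset[OF gL2]])
    then show False using gnz by (simp add: nonzero_L2_def)
  qed
  then obtain z where z: "L2_inner mG g (atom z) \<noteq> 0" by (elim exE)
  let ?d = "cmod (L2_inner mG g (atom z))"
  have d: "?d > 0" using z by simp
  let ?W = "\<integral>v. cmod (STFT mG g f v) \<partial>(mG \<Otimes>\<^sub>M mD)"
  have W: "(\<integral>\<^sup>+v. ennreal (cmod (STFT mG g f v)) \<partial>(mG \<Otimes>\<^sub>M mD)) = ennreal ?W"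
    using integrable_norm[OF V] by (rule nn_integral_eq_integral) simp
  have W0: "?W \<ge> 0" by (rule integral_nonneg_AE) simp
  note [measurable] = borel_measurable_integrable[OF V]
  have L: "coset cell v \<in> sets (mG \<Otimes>\<^sub>M mD)" for v
  proof -
    have "coset cell v = coset H (fst v) \<times> coset (annihilator H) (snd v)"
      by (auto simp: coset_def cell_def mem_Times_iff)
    then show ?thesis by (simp add: pair_measureI)
  qed
  note [measurable] = L
  have bound: "(\<Sum>n\<in>F. cmod (L2_inner mG f (atom (plane_rep n)))) \<le> ?W / ?d"
    if F: "F \<subseteq> range plane_index" "finite F" for F
  proof -
    have disjoint: "(\<Sum>n\<in>F. indicator (coset cell (plane_rep n - z)) v :: ennreal) \<le> 1" for v
    proof (cases "\<exists>m\<in>F. v \<in> coset cell (plane_rep m - z)")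
      case True
      then obtain m where m: "m \<in> F" "v - (plane_rep m - z) \<in> cell"
        by (auto simp: coset_def)
      have "indicator (coset cell (plane_rep n - z)) v = (0 :: ennreal)" if n: "n \<in> F - {m}" for n
      proof -
        have "v - (plane_rep n - z) \<notin> cell"
        proof
          assume "v - (plane_rep n - z) \<in> cell"
          from add_subgroup_diff[OF add_subgroup_cell this m(2)]
          have "plane_rep m - plane_rep n \<in> cell" by (simp add: algebra_simps)
          then show False using plane_rep_separated[of m n] n m F by auto
        qed
        then show ?thesis by (simp add: coset_def)
      qed
      then have "(\<Sum>n\<in>F. indicator (coset cell (plane_rep n - z)) v :: ennreal)
          = (\<Sum>n\<in>{m}. indicator (coset cell (plane_rep n - z)) v)"
        using F(2) m(1) by (intro sum.mono_neutral_right) simp_all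
      also have "\<dots> = indicator (coset cell (plane_rep m - z)) v" by simp
      also have "\<dots> \<le> 1" by (simp add: indicator_def)
      finally show ?thesis .
    next
      case False
      then have "indicator (coset cell (plane_rep n - z)) v = (0 :: ennreal)" if "n \<in> F" for n
        using that by (simp add: indicator_def)
      then have "(\<Sum>n\<in>F. indicator (coset cell (plane_rep n - z)) v :: ennreal) = (\<Sum>n\<in>F. 0)"
        by (intro sum.cong refl)
      then show ?thesis by simp
    qed
    have "ennreal ((\<Sum>n\<in>F. cmod (L2_inner mG f (atom (plane_rep n)))) * ?d)
        = (\<Sum>n\<in>F. ennreal (cmod (L2_inner mG f (atom (plane_rep n))) * ?d))"
      by (simp add: sum_distrib_right)
    also have "\<dots> \<le> (\<Sum>n\<in>F. \<integral>\<^sup>+v. indicator (coset cell (plane_rep n - z)) v *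
        ennreal (cmod (STFT mG g f v)) \<partial>(mG \<Otimes>\<^sub>M mD))"
      by (intro sum_mono coefficient_bound fL2 gL2) measurable
    also have "\<dots> = (\<integral>\<^sup>+v. (\<Sum>n\<in>F. indicator (coset cell (plane_rep n - z)) v *
        ennreal (cmod (STFT mG g f v))) \<partial>(mG \<Otimes>\<^sub>M mD))"
      by (rule nn_integral_sum[symmetric]) measurable
    also have "\<dots> = (\<integral>\<^sup>+v. (\<Sum>n\<in>F. indicator (coset cell (plane_rep n - z)) v) *
        ennreal (cmod (STFT mG g f v)) \<partial>(mG \<Otimes>\<^sub>M mD))"
      by (simp only: sum_distrib_right)
    also have "\<dots> \<le> (\<integral>\<^sup>+v. 1 * ennreal (cmod (STFT mG g f v)) \<partial>(mG \<Otimes>\<^sub>M mD))"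
      by (intro nn_integral_mono mult_right_mono disjoint) simp
    also have "\<dots> = ennreal ?W" using W by simp
    finally have "(\<Sum>n\<in>F. cmod (L2_inner mG f (atom (plane_rep n)))) * ?d \<le> ?W"
      using W0 by (simp add: ennreal_le_iff)
    then show ?thesis using d by (simp add: pos_le_divide_eq)
  qed
  show ?thesis
    using bound by (intro exI[of _ "?W / ?d"]) auto
qed

section \<open>The expansion of the window\<close>

text \<open>Setting the coefficient to zero outside the transversal lets the expansion run over
  all natural numbers.\<close>

definition coefficient :: "('a \<Rightarrow> complex) \<Rightarrow> nat \<Rightarrow> complex" where
  "coefficient f n = (if n \<in> range plane_index then L2_inner mG f (atom (plane_rep n)) else 0)"

lemma integral_norm_atom: "(\<integral>y. cmod (atom z y) \<partial>mG) = 1"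
proof -
  have "(\<integral>y. cmod (atom z y) \<partial>mG) = measure mG (coset H (fst z))"
    by (simp add: norm_atom)
  then show ?thesis using emeasure_coset[of "fst z"] by (simp add: measure_def)
qed

text \<open>The series converges to a bounded function that has the same inner products with all
  atoms as \<^term>\<open>f\<close>, so completeness applies to the difference.\<close>

lemma window_expansion:
  assumes f: "f \<in> L2 mG" and c: "summable (\<lambda>n. cmod (coefficient f n))"
  shows "AE y in mG. f y = (\<Sum>n. coefficient f n * atom (plane_rep n) y)"
proof -
  define s where "s y = (\<Sum>n. coefficient f n * atom (plane_rep n) y)" for y
  have s_meas: "s \<in> borel_measurable mG"
    unfolding s_def by measurable
  have abs: "summable (\<lambda>n. coefficient f n * atom (plane_rep n) y)" for y
  proof (rule summable_comparison_test'[OF c, of 0])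
    show "norm (coefficient f n * atom (plane_rep n) y) \<le> cmod (coefficient f n)" for n
      by (simp add: norm_mult norm_atom indicator_def)
  qed
  let ?k = "\<lambda>z n y. atom (plane_rep n) y * cnj (atom z y)"
  have k: "integrable mG (?k z n)" for z n
    by (rule L2_mult_integrable[OF atom_L2 atom_L2])
  have k1: "cmod (?k z n y) \<le> 1" for z n y
    by (simp add: norm_mult norm_atom indicator_def)
  have "(\<integral>y. cmod (?k z n y) \<partial>mG) \<le> (\<integral>y. cmod (atom z y) \<partial>mG)" for z n
  proof (rule integral_mono)
    show "integrable mG (\<lambda>y. cmod (?k z n y))" using k by (rule integrable_norm)
    show "integrable mG (\<lambda>y. cmod (atom z y))"
      using integrable_indicator_coset by (simp add: norm_atom)
  qed (simp add: norm_mult norm_atom indicator_def)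
  then have k2: "(\<integral>y. cmod (?k z n y) \<partial>mG) \<le> 1" for z n
    by (simp add: integral_norm_atom)
  have ser: "s y * cnj (atom z y) = (\<Sum>n. coefficient f n * ?k z n y)" for y z
    unfolding s_def suminf_mult2[OF abs] by (simp add: mult.assoc)
  have s_int: "integrable mG (\<lambda>y. s y * cnj (atom z y))" for z
    unfolding ser by (rule integrable_weighted_series[OF c k k1 k2])
  have s_inner: "L2_inner mG s (atom (plane_rep m)) = coefficient f m" if m: "m \<in> range plane_index" for m
  proof -
    have "(\<lambda>n. coefficient f n * L2_inner mG (atom (plane_rep n)) (atom (plane_rep m)))
        sums L2_inner mG s (atom (plane_rep m))"
      unfolding L2_inner_def ser by (rule sums_weighted_series[OF c k k1 k2])
    moreover have "coefficient f n * L2_inner mG (atom (plane_rep n)) (atom (plane_rep m))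
        = (if n = m then coefficient f m else 0)" for n
      using plane_rep_separated[OF _ m, of n] add_subgroupD(1)[OF add_subgroup_cell]
      by (auto simp: atom_inner coefficient_def)
    ultimately have "(\<lambda>n. if n = m then coefficient f m else 0) sums L2_inner mG s (atom (plane_rep m))"
      by simp
    then show ?thesis using sums_unique2 sums_single[of m "\<lambda>_. coefficient f m"] by blast
  qed
  define \<psi> where "\<psi> y = f y - s y" for y
  have "AE y in mG. \<psi> y = 0"
  proof (rule atoms_complete)
    show "\<psi> \<in> borel_measurable mG"
      unfolding \<psi>_def using L2_measurable[OF f] s_meas by measurable
    show "integrable mG (\<lambda>y. indicator (coset H a) y * \<psi> y)" for a
    proof -
      have "(\<lambda>y. indicator (coset H a) y * \<psi> y) = (\<lambda>y. indicator (coset H a) y * f y - s y * cnj (atom (a, 0) y))"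
        by (auto simp: \<psi>_def atom_def indicator_def)
      then show ?thesis
        using Bochner_Integration.integrable_diff[OF L2_integrable_coset[OF f] s_int] by simp
    qed
    show "L2_inner mG \<psi> (atom z) = 0" for z
    proof -
      let ?m = "plane_index z"
      have "L2_inner mG \<psi> (atom (plane_rep ?m))
          = L2_inner mG f (atom (plane_rep ?m)) - L2_inner mG s (atom (plane_rep ?m))"
        unfolding L2_inner_def \<psi>_def left_diff_distrib
        by (rule Bochner_Integration.integral_diff[OF L2_mult_integrable[OF f atom_L2] s_int])
      also have "\<dots> = 0" by (simp add: s_inner coefficient_def)
      finally show ?thesis using inner_atom_phase[OF plane_index[of z], of \<psi>] by simp
    qed
  qed
  then show ?thesis
    by (rule AE_mp) (simp add: \<psi>_def s_def)
qed

lemma time_frequency_shift_atom: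
  "time_frequency_shift z (atom w) y = cnj (pairing (fst z) (snd w)) * atom (z + w) y"
  by (simp add: time_frequency_shift_eq atom_def pairing_add_right pairing_diff_left coset_def
      indicator_def diff_diff_eq mult_ac)

lemma shifted_window_expansion:
  assumes f: "f \<in> L2 mG" and h: "h \<in> L2 mG" and c: "summable (\<lambda>n. cmod (coefficient h n))"
  shows "(\<lambda>n. cnj (coefficient h n) * L2_inner mG f (time_frequency_shift z (atom (plane_rep n))))
    sums L2_inner mG f (time_frequency_shift z h)"
proof -
  let ?e = "\<lambda>n. time_frequency_shift z (atom (plane_rep n))"
  let ?k = "\<lambda>n y. f y * cnj (?e n y)"
  define s where "s y = (\<Sum>n. coefficient h n * atom (plane_rep n) y)" for y
  have e_norm: "cmod (?e n y) = indicator (coset H (fst z + fst (plane_rep n))) y" for n y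
    by (simp add: time_frequency_shift_atom norm_mult norm_atom)
  have k: "integrable mG (?k n)" for n
    by (rule L2_mult_integrable[OF f L2_time_frequency_shift[OF atom_L2]])
  have w: "cmod (?k n y) \<le> cmod (f y)" for n y
    by (simp add: norm_mult e_norm indicator_def)
  have B: "(\<integral>y. cmod (?k n y) \<partial>mG) \<le> (\<integral>y. (cmod (f y))\<^sup>2 \<partial>mG) + 1" for n
  proof -
    let ?C = "coset H (fst z + fst (plane_rep n))"
    \<comment> \<open>termwise integration only needs some bound that is uniform in the index, so this crude estimate is enough\<close>
    have "t \<le> t\<^sup>2 + 1" for t :: real
      using zero_le_power2[of "t - 1/2"] by (simp add: power2_eq_square algebra_simps)
    then have le: "cmod (?k n y) \<le> (cmod (f y))\<^sup>2 + indicator ?C y" for y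
      by (simp add: norm_mult e_norm indicator_def)
    have "(\<integral>y. cmod (?k n y) \<partial>mG) \<le> (\<integral>y. (cmod (f y))\<^sup>2 + indicator ?C y \<partial>mG)"
      using k L2_integrable[OF f] integrable_indicator_coset le
      by (intro integral_mono integrable_norm Bochner_Integration.integrable_add)
    also have "\<dots> = (\<integral>y. (cmod (f y))\<^sup>2 \<partial>mG) + measure mG ?C"
      using L2_integrable[OF f] integrable_indicator_coset by simp
    also have "measure mG ?C = 1"
      using emeasure_coset by (simp add: measure_def)
    finally show ?thesis .
  qed
  have c': "summable (\<lambda>n. cmod (cnj (coefficient h n)))" using c by simp
  have abs: "summable (\<lambda>n. coefficient h n * atom (plane_rep n) y)" for y
  proof (rule summable_comparison_test'[OF c, of 0])
    show "norm (coefficient h n * atom (plane_rep n) y) \<le> cmod (coefficient h n)" for n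
      by (simp add: norm_mult norm_atom indicator_def)
  qed
  have ser: "f y * cnj (time_frequency_shift z s y) = (\<Sum>n. cnj (coefficient h n) * ?k n y)" for y
  proof -
    have "(\<lambda>n. coefficient h n * atom (plane_rep n) (y - fst z)) sums s (y - fst z)"
      unfolding s_def by (rule summable_sums[OF abs])
    then have "(\<lambda>n. cnj (coefficient h n * atom (plane_rep n) (y - fst z))) sums cnj (s (y - fst z))"
      by (simp only: sums_cnj)
    then have "(\<lambda>n. (f y * cnj (pairing y (snd z))) * cnj (coefficient h n * atom (plane_rep n) (y - fst z)))
        sums ((f y * cnj (pairing y (snd z))) * cnj (s (y - fst z)))"
      by (rule sums_mult)
    then show ?thesis
      by (simp add: time_frequency_shift_eq sums_iff mult_ac)
  qed
  have "AE y in mG. h y = s y"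
    using window_expansion[OF h c] by (simp add: s_def)
  from haar_AE_translation[OF mG this, of "- fst z"]
  have ae: "AE y in mG. h (y - fst z) = s (y - fst z)" by simp
  have sh_meas: "(\<lambda>y. f y * cnj (time_frequency_shift z s y)) \<in> borel_measurable mG"
    unfolding ser by (rule borel_measurable_suminf)
      (intro borel_measurable_times borel_measurable_const borel_measurable_integrable[OF k])
  have "L2_inner mG f (time_frequency_shift z h) = L2_inner mG f (time_frequency_shift z s)"
    unfolding L2_inner_def
    by (rule integral_cong_AE[OF borel_measurable_integrable[OF
            L2_mult_integrable[OF f L2_time_frequency_shift[OF h]]] sh_meas])
      (rule AE_mp[OF ae], simp add: time_frequency_shift_eq)
  also have "\<dots> = (\<integral>y. (\<Sum>n. cnj (coefficient h n) * ?k n y) \<partial>mG)"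
    unfolding L2_inner_def ser ..
  finally show ?thesis
    using sums_weighted_series[OF c' k w B] by (simp add: L2_inner_def)
qed

section \<open>Counting and the Bessel bound\<close>

text \<open>Up to a phase, each atom of the transversal occurs at most \<^term>\<open>C\<close>
  times among the shifted ones, so Bessel's inequality costs a factor \<^term>\<open>C\<close>.\<close>

lemma atom_samples_bound:
  assumes f: "f \<in> L2 mG" and F: "finite F"
    and C: "\<And>z E. E \<subseteq> {i\<in>F. \<Lambda> i \<in> coset cell z} \<Longrightarrow> real (card E) \<le> C"
  shows "(\<Sum>i\<in>F. (cmod (L2_inner mG f (atom (\<Lambda> i + w))))\<^sup>2) \<le> C * (\<integral>x. (cmod (f x))\<^sup>2 \<partial>mG)"
proof -
  let ?g = "\<lambda>i. plane_index (\<Lambda> i + w)"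
  let ?v = "\<lambda>n. (cmod (L2_inner mG f (atom (plane_rep n))))\<^sup>2"
  have "C \<ge> 0" using C[of "{}"] by simp
  have "(\<Sum>i\<in>F. (cmod (L2_inner mG f (atom (\<Lambda> i + w))))\<^sup>2) = (\<Sum>i\<in>F. ?v (?g i))"
    by (intro sum.cong refl arg_cong[where f = "\<lambda>t. t\<^sup>2"] inner_atom_cong plane_index)
  also have "\<dots> = (\<Sum>n\<in>?g ` F. of_nat (card {i\<in>F. ?g i = n}) * ?v n)"
    using F by (intro sum_fun_comp) auto
  also have "\<dots> \<le> (\<Sum>n\<in>?g ` F. C * ?v n)"
  proof (intro sum_mono mult_right_mono)
    fix n
    have "{i\<in>F. ?g i = n} \<subseteq> {i\<in>F. \<Lambda> i \<in> coset cell (plane_rep n - w)}"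
    proof (intro subsetI CollectI conjI)
      fix i assume i: "i \<in> {i\<in>F. ?g i = n}"
      then have "\<Lambda> i + w - plane_rep n \<in> cell" using plane_index[of "\<Lambda> i + w"] by simp
      then show "\<Lambda> i \<in> coset cell (plane_rep n - w)"
        by (simp add: coset_def diff_diff_eq2)
    qed simp
    then show "of_nat (card {i\<in>F. ?g i = n}) \<le> C" by (rule C)
  qed simp
  also have "\<dots> = C * (\<Sum>n\<in>?g ` F. ?v n)"
    by (rule sum_distrib_left[symmetric])
  also have "\<dots> \<le> C * (\<integral>x. (cmod (f x))\<^sup>2 \<partial>mG)"
  proof (intro mult_left_mono atoms_bessel[OF _ f])
    show "m = n" if "m \<in> ?g ` F" "n \<in> ?g ` F" "plane_rep m - plane_rep n \<in> cell" for m n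
      using that by (intro plane_rep_separated) auto
  qed (use F \<open>C \<ge> 0\<close> in simp_all)
  finally show ?thesis .
qed

lemma cell_coset_subset_Q_box: "coset cell z \<subseteq> Q_box A H (int n) z"
proof -
  let ?B = "adjoint_aut A"
  have "annihilator H \<subseteq> ?B ` annihilator H"
    using A_adjoint_expansive by (auto simp: expansive_def)
  then have "annihilator H \<subseteq> (?B ^^ n) ` annihilator H"
  proof (induction n)
    case (Suc n)
    then have "?B ` annihilator H \<subseteq> ?B ` (?B ^^ n) ` annihilator H" by (intro image_mono)
    then show ?case using Suc.prems by (simp add: image_comp)
  qed simp
  moreover have "H \<subseteq> (A ^^ n) ` H"
    using dilate_mono[of 0 n] by (simp add: dilate_def)
  ultimately show ?thesis
    unfolding Q_box_def image_add_eq_coset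
    by (auto simp: coset_def cell_def zpow_def mem_Times_iff)
qed

text \<open>A finite limit superior makes some quotient finite, and division by a finite number
  cannot turn an infinite supremum into a finite one. The boxes of that size contain all cosets
  of the cell.\<close>

lemma finite_density_imp_bounded_cosets:
  assumes "upper_density mG A H I \<Lambda> < \<infinity>"
  shows "\<exists>C\<ge>0. \<forall>z E. finite E \<longrightarrow> E \<subseteq> {i\<in>I. \<Lambda> i \<in> coset cell z} \<longrightarrow> real (card E) \<le> C"
proof -
  let ?N = "\<lambda>n. (SUP z. emeasure (count_space UNIV) {i\<in>I. \<Lambda> i \<in> Q_box A H (int n) z})"
  have "\<exists>n. ?N n / ennreal (modulus mG A ^ (2 * n)) \<noteq> \<infinity>"
  proof (rule ccontr)
    assume "\<nexists>n. ?N n / ennreal (modulus mG A ^ (2 * n)) \<noteq> \<infinity>"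
    then have "upper_density mG A H I \<Lambda> = limsup (\<lambda>n::nat. \<infinity>)"
      unfolding upper_density_def by simp
    then show False using assms by (simp add: Limsup_const)
  qed
  then obtain n where n: "?N n / ennreal (modulus mG A ^ (2 * n)) \<noteq> \<infinity>" by (elim exE)
  have "a \<noteq> \<infinity>" if "a / ennreal x \<noteq> \<infinity>" for a x
    using that by (auto simp: ennreal_top_divide)
  from this[OF n] have N: "?N n \<noteq> \<infinity>" .
  have "real (card E) \<le> enn2real (?N n)"
    if E: "finite E" "E \<subseteq> {i\<in>I. \<Lambda> i \<in> coset cell z}" for z E
  proof -
    have "E \<subseteq> {i\<in>I. \<Lambda> i \<in> Q_box A H (int n) z}"
      using E(2) cell_coset_subset_Q_box[of z n] by auto
    then have "emeasure (count_space UNIV) E \<le> emeasure (count_space UNIV) {i\<in>I. \<Lambda> i \<in> Q_box A H (int n) z}"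
      by (intro emeasure_mono) auto
    also have "\<dots> \<le> ?N n" by (rule SUP_upper) simp
    finally have "ennreal (real (card E)) \<le> ?N n"
      using E(1) by (simp add: ennreal_of_nat_eq_real_of_nat)
    moreover have "?N n < top"
      using N unfolding infinity_ennreal_def less_top .
    ultimately have "enn2real (ennreal (real (card E))) \<le> enn2real (?N n)"
      by (rule enn2real_mono)
    then show ?thesis by simp
  qed
  then show ?thesis by (intro exI[of _ "enn2real (?N n)"]) auto
qed

text \<open>Inserting the expansion of \<^term>\<open>h\<close> writes the vector of samples as
  a combination of sample vectors of atoms with weights of total size at most
  \<^term>\<open>S\<close>; the triangle inequality for the Euclidean norm then gives the bound
  for every partial sum.\<close>

lemma gabor_samples_bound:
  assumes f: "f \<in> L2 mG" and h: "h \<in> L2 mG" and F: "finite F"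
    and S: "\<And>E. E \<subseteq> range plane_index \<Longrightarrow> finite E \<Longrightarrow> (\<Sum>n\<in>E. cmod (L2_inner mG h (atom (plane_rep n)))) \<le> S"
    and C: "\<And>z E. E \<subseteq> {i\<in>F. \<Lambda> i \<in> coset cell z} \<Longrightarrow> real (card E) \<le> C"
  shows "(\<Sum>i\<in>F. (cmod (L2_inner mG f (time_frequency_shift (\<Lambda> i) h)))\<^sup>2)
    \<le> S\<^sup>2 * C * (\<integral>x. (cmod (f x))\<^sup>2 \<partial>mG)"
proof -
  let ?c = "coefficient h"
  let ?d = "\<lambda>n i. L2_inner mG f (time_frequency_shift (\<Lambda> i) (atom (plane_rep n)))"
  let ?R = "C * (\<integral>x. (cmod (f x))\<^sup>2 \<partial>mG)"
  have "C \<ge> 0" using C[of "{}"] by simp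
  then have R: "?R \<ge> 0" by (intro mult_nonneg_nonneg integral_nonneg_AE) simp_all
  have partial: "(\<Sum>n<K. cmod (?c n)) \<le> S" for K
  proof -
    have "(\<Sum>n<K. cmod (?c n)) = (\<Sum>n\<in>{..<K} \<inter> range plane_index. cmod (L2_inner mG h (atom (plane_rep n))))"
      by (simp add: coefficient_def if_distrib sum.inter_restrict cong: if_cong)
    also have "\<dots> \<le> S" by (rule S) auto
    finally show ?thesis .
  qed
  then have c: "summable (\<lambda>n. cmod (?c n))"
    by (intro summableI_nonneg_bounded) auto
  have d: "cmod (?d n i) = cmod (L2_inner mG f (atom (\<Lambda> i + plane_rep n)))" for n i
  proof -
    have "?d n i = (\<integral>y. pairing (fst (\<Lambda> i)) (snd (plane_rep n)) * (f y * cnj (atom (\<Lambda> i + plane_rep n) y)) \<partial>mG)"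
      unfolding L2_inner_def time_frequency_shift_atom
      by (intro Bochner_Integration.integral_cong) (simp_all add: mult_ac)
    also have "\<dots> = pairing (fst (\<Lambda> i)) (snd (plane_rep n)) * L2_inner mG f (atom (\<Lambda> i + plane_rep n))"
      unfolding L2_inner_def by (rule integral_mult_right_zero)
    finally show ?thesis by (simp add: norm_mult)
  qed
  have each: "L2_set (\<lambda>i. cmod (?d n i)) F \<le> sqrt ?R" for n
    unfolding L2_set_def d by (intro real_sqrt_le_mono atom_samples_bound f F C)
  have finite_part: "L2_set (\<lambda>i. cmod (\<Sum>n<K. cnj (?c n) * ?d n i)) F \<le> (\<Sum>n<K. cmod (?c n)) * sqrt ?R" for K
  proof (induction K)
    case (Suc K)
    have "L2_set (\<lambda>i. cmod (\<Sum>n<Suc K. cnj (?c n) * ?d n i)) F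
        \<le> L2_set (\<lambda>i. cmod (\<Sum>n<K. cnj (?c n) * ?d n i) + cmod (?c K) * cmod (?d K i)) F"
    proof (rule L2_set_mono)
      fix i
      show "cmod (\<Sum>n<Suc K. cnj (?c n) * ?d n i)
          \<le> cmod (\<Sum>n<K. cnj (?c n) * ?d n i) + cmod (?c K) * cmod (?d K i)"
        using norm_triangle_ineq[of "\<Sum>n<K. cnj (?c n) * ?d n i" "cnj (?c K) * ?d K i"]
        by (simp add: norm_mult)
    qed simp
    also have "\<dots> \<le> L2_set (\<lambda>i. cmod (\<Sum>n<K. cnj (?c n) * ?d n i)) F + L2_set (\<lambda>i. cmod (?c K) * cmod (?d K i)) F"
      by (rule L2_set_triangle_ineq)
    also have "L2_set (\<lambda>i. cmod (?c K) * cmod (?d K i)) F = cmod (?c K) * L2_set (\<lambda>i. cmod (?d K i)) F"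
      by (simp add: L2_set_right_distrib)
    also have "L2_set (\<lambda>i. cmod (\<Sum>n<K. cnj (?c n) * ?d n i)) F + cmod (?c K) * L2_set (\<lambda>i. cmod (?d K i)) F
        \<le> (\<Sum>n<K. cmod (?c n)) * sqrt ?R + cmod (?c K) * sqrt ?R"
      by (intro add_mono Suc.IH mult_left_mono each) simp
    finally show ?case by (simp add: distrib_right)
  qed (simp add: L2_set_def)
  have sum_le: "(\<Sum>i\<in>F. (cmod (\<Sum>n<K. cnj (?c n) * ?d n i))\<^sup>2) \<le> (S * sqrt ?R)\<^sup>2" for K
  proof -
    have "L2_set (\<lambda>i. cmod (\<Sum>n<K. cnj (?c n) * ?d n i)) F \<le> S * sqrt ?R"
      using finite_part[of K] mult_right_mono[OF partial[of K], of "sqrt ?R"] R by simp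
    then have "(L2_set (\<lambda>i. cmod (\<Sum>n<K. cnj (?c n) * ?d n i)) F)\<^sup>2 \<le> (S * sqrt ?R)\<^sup>2"
      by (rule power_mono) simp
    then show ?thesis by (simp add: L2_set_def sum_nonneg)
  qed
  have "(\<lambda>K. \<Sum>i\<in>F. (cmod (\<Sum>n<K. cnj (?c n) * ?d n i))\<^sup>2)
      \<longlonglongrightarrow> (\<Sum>i\<in>F. (cmod (L2_inner mG f (time_frequency_shift (\<Lambda> i) h)))\<^sup>2)"
    using shifted_window_expansion[OF f h c] unfolding sums_def by (intro tendsto_intros)
  then have "(\<Sum>i\<in>F. (cmod (L2_inner mG f (time_frequency_shift (\<Lambda> i) h)))\<^sup>2) \<le> (S * sqrt ?R)\<^sup>2"
    by (rule LIMSEQ_le_const2) (use sum_le in blast)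
  then show ?thesis using R by (simp add: power_mult_distrib mult.assoc)
qed

end

theorem theorem5p1p3:
  fixes A :: "'a::{topological_ab_group_add, t2_space} \<Rightarrow> 'a"
    and H :: "'a set"
    and mG :: "'a measure"
    and mD :: "'a pdual measure"
    and g \<phi> :: "'a \<Rightarrow> complex"
    and I :: "'i set"
    and \<Lambda> :: "'i \<Rightarrow> 'a \<times> 'a pdual"
  assumes "locally_compact_space (euclidean :: 'a topology)"
    and "add_subgroup H" and "compact H" and "open H"
    and "haar_measure mG" and "emeasure mG H = 1"
    and "haar_measure mD" and "emeasure mD (annihilator H) = 1"
    and "A \<in> Aut" and "expansive A H"
    and "expansive (adjoint_aut A) (annihilator H)"
    and "admissible_window mG mD g"
    and "\<phi> \<in> modulation_space_M1 mG mD g" and "nonzero_L2 mG \<phi>"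
    and "upper_density mG A H I \<Lambda> < \<infinity>"
  shows "Bessel_sequence mG I (gabor_system \<phi> \<Lambda>)"
proof -
  interpret expansive_haar A H mG mD
    using assms by unfold_locales
  have \<phi>: "\<phi> \<in> L2 mG"
    using assms(13) by (simp add: modulation_space_M1_def)
  obtain S where S: "\<forall>F\<subseteq>range plane_index. finite F \<longrightarrow>
      (\<Sum>n\<in>F. cmod (L2_inner mG \<phi> (atom (plane_rep n)))) \<le> S"
    using coefficients_bounded_sums[OF assms(12,13)] by (elim exE)
  obtain C where "C \<ge> 0" and C: "\<forall>z E. finite E \<longrightarrow> E \<subseteq> {i\<in>I. \<Lambda> i \<in> coset cell z} \<longrightarrow> real (card E) \<le> C"
    using finite_density_imp_bounded_cosets[OF assms(15)] by (elim exE conjE)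
  \<comment> \<open>the summand 1 only makes the bound positive\<close>
  let ?B = "S\<^sup>2 * C + 1"
  have B: "?B > 0" using \<open>C \<ge> 0\<close> by (intro add_nonneg_pos mult_nonneg_nonneg) simp_all
  have "(\<Sum>\<^sub>\<infinity>i\<in>I. ennreal ((cmod (L2_inner mG f (gabor_system \<phi> \<Lambda> i)))\<^sup>2))
      \<le> ennreal (?B * (\<integral>x. (cmod (f x))\<^sup>2 \<partial>mG))" if f: "f \<in> L2 mG" for f
  proof -
    have "(\<Sum>i\<in>F. ennreal ((cmod (L2_inner mG f (gabor_system \<phi> \<Lambda> i)))\<^sup>2))
        \<le> ennreal (?B * (\<integral>x. (cmod (f x))\<^sup>2 \<partial>mG))" if F: "finite F" "F \<subseteq> I" for F
    proof -
      have "(\<Sum>i\<in>F. (cmod (L2_inner mG f (time_frequency_shift (\<Lambda> i) \<phi>)))\<^sup>2)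
          \<le> S\<^sup>2 * C * (\<integral>x. (cmod (f x))\<^sup>2 \<partial>mG)"
      proof (rule gabor_samples_bound[OF f \<phi> F(1)])
        show "(\<Sum>n\<in>E. cmod (L2_inner mG \<phi> (atom (plane_rep n)))) \<le> S"
          if "E \<subseteq> range plane_index" "finite E" for E
          using S that by simp
        show "real (card E) \<le> C" if E: "E \<subseteq> {i\<in>F. \<Lambda> i \<in> coset cell z}" for z E
        proof -
          have "finite E" using E F(1) by (auto intro: finite_subset)
          moreover have "E \<subseteq> {i\<in>I. \<Lambda> i \<in> coset cell z}" using E F(2) by auto
          ultimately show ?thesis by (rule C[rule_format])
        qed
      qed
      also have "\<dots> \<le> ?B * (\<integral>x. (cmod (f x))\<^sup>2 \<partial>mG)"
        by (intro mult_right_mono integral_nonneg_AE) simp_all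
      finally show ?thesis
        by (simp add: gabor_system_def sum_ennreal ennreal_leI)
    qed
    then show ?thesis
      by (subst nonneg_infsum_complete) (auto intro!: SUP_least)
  qed
  moreover have "gabor_system \<phi> \<Lambda> i \<in> L2 mG" for i
    unfolding gabor_system_def by (rule L2_time_frequency_shift[OF \<phi>])
  ultimately show ?thesis
    unfolding Bessel_sequence_def using B by (intro conjI ballI exI[of _ ?B]) auto
qed

end
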